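(* Let $1<\gamma<3$, $\mu\ge 1$, $0\le\lambda\le 2$, $m>0$, $\delta>0$ and $(u_0,v_0)\in X_{m,\delta}$. Let $(u,v)$ be the $C^1$ solution of the Cauchy problem $$u_t-v_x=0,\qquad v_t+p(u)_x=-\frac{\lambda}{(1+t)^\mu}v,\qquad (u,v)(0,x)=(u_0(x),v_0(x)),$$ with lifespan $T^*$. If for some $x_0\in\mathbb{R}$ $$\sqrt{c_0(x_0)}\,r_x(0,x_0)<-\frac{\lambda}{2}\theta_\gamma(u_0(x_0))\quad\text{or}\quad \sqrt{c_0(x_0)}\,s_x(0,x_0)<-\frac{\lambda}{2}\theta_\gamma(u_0(x_0)),$$ then $T^*<\infty$ and there exist $m_1>0$ and $\delta_1>0$ such that $(u(t),v(t))\in X_{m_1,\delta_1}$ for all $t\in[0,T^* )$.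
   Context: Pressure: $p(u)=u^{-\gamma}/\gamma$ with $\gamma>1$. Put $c(u)=\sqrt{-p'(u)}=u^{-(\gamma+1)/2}$, $c_0(x)=\sqrt{-p'(u_0(x))}$, and $\eta(u)=\int_u^\infty c(\xi)\,d\xi=\frac{2}{\gamma-1}u^{-(\gamma-1)/2}$. For a solution $(u,v)$ with $u>0$, the Riemann invariants are $r(t,x)=v(t,x)-\eta(u(t,x))$ and $s(t,x)=v(t,x)+\eta(u(t,x))$; at $t=0$ they are computed from $(u_0,v_0)$. For $\gamma\ne3$, $\theta_\gamma(u)=\frac{4}{3-\gamma}u^{\frac{3-\gamma}{4}}$. $C^1_b(\mathbb{R})$ is the set of bounded $C^1$ functions with bounded first derivative. For $m,\delta>0$, $$X_{m,\delta}=\{(u,v)\in C^1_b(\mathbb{R})\times C^1_b(\mathbb{R}) : \|u\|_{L^\infty}+\|v\|_{L^\infty}\le m,\ u(x)\ge\delta\ \text{for all }x\in\mathbb{R}\}.$$ For initial data in $C^1_b(\mathbb{R})$ with $\inf u_0>0$ the Cauchy problem ($t\ge0$, $x\in\mathbb{R}$) has a unique local $C^1$ solution. The lifespan is $$T^*=\sup\Big\{T>0 : \text{the }C^1\text{ solution exists on }[0,T)\times\mathbb{R}\text{ and }\sup_{t\in[0,T)}\big(\|(u,v)(t)\|_{L^\infty}+\|(u_t,v_t)(t)\|_{L^\infty}+\|(u_x,v_x)(t)\|_{L^\infty}+\|p'(u(t))\|_{L^\infty}\big)<\infty\Big\}.$$ *)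

theory Defs
  imports "HOL-Analysis.Analysis"
begin

definition pressure :: "real \<Rightarrow> real \<Rightarrow> real" where
  "pressure \<gamma> u = u powr (- \<gamma>) / \<gamma>"

definition wave_speed :: "real \<Rightarrow> real \<Rightarrow> real" where
  "wave_speed \<gamma> u = sqrt (- deriv (pressure \<gamma>) u)"

definition eta :: "real \<Rightarrow> real \<Rightarrow> real" where
  "eta \<gamma> u = integral {u..} (wave_speed \<gamma>)"

text \<open>The Riemann invariants of a state given as a pair of functions of the space variable.\<close>

definition riemann_r :: "real \<Rightarrow> (real \<Rightarrow> real) \<Rightarrow> (real \<Rightarrow> real) \<Rightarrow> real \<Rightarrow> real" where
  "riemann_r \<gamma> u v x = v x - eta \<gamma> (u x)"

definition riemann_s :: "real \<Rightarrow> (real \<Rightarrow> real) \<Rightarrow> (real \<Rightarrow> real) \<Rightarrow> real \<Rightarrow> real" where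
  "riemann_s \<gamma> u v x = v x + eta \<gamma> (u x)"

definition theta :: "real \<Rightarrow> real \<Rightarrow> real" where
  "theta \<gamma> u = 4 / (3 - \<gamma>) * u powr ((3 - \<gamma>) / 4)"

lemma deriv_pressure:
  assumes "\<gamma> > 0" "u > 0"
  shows "deriv (pressure \<gamma>) u = - (u powr (- (\<gamma> + 1)))"
proof -
  have "((\<lambda>w. w powr (- \<gamma>) / \<gamma>) has_real_derivative - (u powr (- (\<gamma> + 1)))) (at u)"
    using assms by (auto intro!: derivative_eq_intros simp: powr_diff)
  then have "(pressure \<gamma> has_real_derivative - (u powr (- (\<gamma> + 1)))) (at u)"
    by (simp add: pressure_def [abs_def])
  then show ?thesis by (rule DERIV_imp_deriv)
qed

lemma wave_speed_eq:
  assumes "\<gamma> > 0" "u > 0"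
  shows "wave_speed \<gamma> u = u powr (- ((\<gamma> + 1) / 2))"
proof -
  have "wave_speed \<gamma> u = (u powr (- (\<gamma> + 1))) powr (1 / 2)"
    using assms by (simp add: wave_speed_def deriv_pressure powr_half_sqrt)
  also have "\<dots> = u powr (- (\<gamma> + 1) * (1 / 2))"
    by (rule powr_powr)
  also have "- (\<gamma> + 1) * (1 / 2) = - ((\<gamma> + 1) / 2)"
    by (simp only: mult_minus_left times_divide_eq_right mult_1_right)
  finally show ?thesis .
qed

lemma eta_eq:
  assumes "\<gamma> > 1" "u > 0"
  shows "eta \<gamma> u = 2 / (\<gamma> - 1) * u powr (- ((\<gamma> - 1) / 2))"
proof -
  have "((\<lambda>\<xi>. \<xi> powr (- ((\<gamma> + 1) / 2))) has_integral
      - (u powr (- ((\<gamma> + 1) / 2) + 1)) / (- ((\<gamma> + 1) / 2) + 1)) {u..}"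
    using assms by (intro has_integral_powr_to_inf) auto
  then have "(wave_speed \<gamma> has_integral
      - (u powr (- ((\<gamma> + 1) / 2) + 1)) / (- ((\<gamma> + 1) / 2) + 1)) {u..}"
    using assms by (subst has_integral_cong) (auto simp: wave_speed_eq)
  moreover have "- ((\<gamma> + 1) / 2) + 1 = - ((\<gamma> - 1) / 2)" by (simp add: field_simps)
  ultimately show ?thesis
    by (simp add: eta_def integral_unique)
qed

text \<open>
  All functions whose \<open>L\<^sup>\<infinity>\<close> norm is taken are continuous, so the norm is the supremum. It takes
  values in the extended reals, an unbounded function having norm \<open>\<infinity>\<close>.
\<close>

definition sup_norm :: "(real \<Rightarrow> real) \<Rightarrow> ereal" where
  "sup_norm f = (SUP x. ereal \<bar>f x\<bar>)"

definition C1b :: "(real \<Rightarrow> real) set" where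
  "C1b = {f. f differentiable_on UNIV \<and> continuous_on UNIV (deriv f) \<and>
             bounded (range f) \<and> bounded (range (deriv f))}"

definition X_space :: "real \<Rightarrow> real \<Rightarrow> ((real \<Rightarrow> real) \<times> (real \<Rightarrow> real)) set" where
  "X_space m \<delta> = {(u, v). u \<in> C1b \<and> v \<in> C1b \<and>
      sup_norm u + sup_norm v \<le> ereal m \<and> (\<forall>x. u x \<ge> \<delta>)}"

text \<open>
  Functions on \<open>[0, T) \<times> \<real>\<close> are total functions of \<open>t\<close> and \<open>x\<close>. Time derivatives are taken
  within \<open>{0..}\<close>, hence are one-sided at \<open>t = 0\<close>; for \<open>0 \<le> t < T\<close> all derivatives depend only
  on the values on \<open>[0, T) \<times> \<real>\<close>.
\<close>

definition Dt :: "(real \<Rightarrow> real \<Rightarrow> real) \<Rightarrow> real \<Rightarrow> real \<Rightarrow> real" where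
  "Dt f t x = vector_derivative (\<lambda>\<tau>. f \<tau> x) (at t within {0..})"

definition Dx :: "(real \<Rightarrow> real \<Rightarrow> real) \<Rightarrow> real \<Rightarrow> real \<Rightarrow> real" where
  "Dx f t x = deriv (f t) x"

definition C1_strip :: "real \<Rightarrow> (real \<Rightarrow> real \<Rightarrow> real) \<Rightarrow> bool" where
  "C1_strip T f \<longleftrightarrow>
     (\<forall>t\<in>{0..<T}. \<forall>x. (\<lambda>\<tau>. f \<tau> x) differentiable (at t within {0..}) \<and>
                       f t differentiable (at x)) \<and>
     continuous_on ({0..<T} \<times> UNIV) (\<lambda>(t, x). f t x) \<and>
     continuous_on ({0..<T} \<times> UNIV) (\<lambda>(t, x). Dt f t x) \<and>
     continuous_on ({0..<T} \<times> UNIV) (\<lambda>(t, x). Dx f t x)"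

definition C1_solution ::
  "real \<Rightarrow> real \<Rightarrow> real \<Rightarrow> (real \<Rightarrow> real) \<Rightarrow> (real \<Rightarrow> real) \<Rightarrow> real \<Rightarrow>
   (real \<Rightarrow> real \<Rightarrow> real) \<Rightarrow> (real \<Rightarrow> real \<Rightarrow> real) \<Rightarrow> bool" where
  "C1_solution \<gamma> \<mu> lam u0 v0 T u v \<longleftrightarrow>
     C1_strip T u \<and> C1_strip T v \<and>
     (\<forall>t\<in>{0..<T}. \<forall>x. u t x > 0) \<and>
     (\<forall>t\<in>{0..<T}. \<forall>x. Dt u t x - Dx v t x = 0) \<and>
     (\<forall>t\<in>{0..<T}. \<forall>x. Dt v t x + Dx (\<lambda>\<tau> y. pressure \<gamma> (u \<tau> y)) t x
                       = - (lam / (1 + t) powr \<mu>) * v t x) \<and>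
     (\<forall>x. u 0 x = u0 x \<and> v 0 x = v0 x)"

definition bounded_strip ::
  "real \<Rightarrow> real \<Rightarrow> (real \<Rightarrow> real \<Rightarrow> real) \<Rightarrow> (real \<Rightarrow> real \<Rightarrow> real) \<Rightarrow> bool" where
  "bounded_strip \<gamma> T u v \<longleftrightarrow>
     (SUP t\<in>{0..<T}.
        (sup_norm (u t) + sup_norm (v t)) +
        (sup_norm (Dt u t) + sup_norm (Dt v t)) +
        (sup_norm (Dx u t) + sup_norm (Dx v t)) +
        sup_norm (\<lambda>x. deriv (pressure \<gamma>) (u t x))) < \<infinity>"

definition lifespan ::
  "real \<Rightarrow> real \<Rightarrow> real \<Rightarrow> (real \<Rightarrow> real) \<Rightarrow> (real \<Rightarrow> real) \<Rightarrow> ereal" where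
  "lifespan \<gamma> \<mu> lam u0 v0 =
     Sup (ereal ` {T. T > 0 \<and> (\<exists>u v. C1_solution \<gamma> \<mu> lam u0 v0 T u v \<and> bounded_strip \<gamma> T u v)})"

text \<open>
  The \<open>C\<^sup>1\<close> solution on \<open>[0, T\<^sup>*)\<close>. Uniqueness holds among solutions with the bounds that enter
  the definition of the lifespan, and by that definition these bounds hold on \<open>[0, T)\<close> for
  every \<open>T < T\<^sup>*\<close>. They need not be uniform up to \<open>T\<^sup>*\<close>.
\<close>

definition C1_solution_upto_lifespan ::
  "real \<Rightarrow> real \<Rightarrow> real \<Rightarrow> (real \<Rightarrow> real) \<Rightarrow> (real \<Rightarrow> real) \<Rightarrow>
   (real \<Rightarrow> real \<Rightarrow> real) \<Rightarrow> (real \<Rightarrow> real \<Rightarrow> real) \<Rightarrow> bool" where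
  "C1_solution_upto_lifespan \<gamma> \<mu> lam u0 v0 u v \<longleftrightarrow>
     (\<forall>T>0. ereal T < lifespan \<gamma> \<mu> lam u0 v0 \<longrightarrow>
        C1_solution \<gamma> \<mu> lam u0 v0 T u v \<and> bounded_strip \<gamma> T u v)"

end

theory Submission
  imports Defs
begin

text \<open>
  Let \<open>a = lam / (1 + t)\<^sup>\<mu>\<close> and let \<open>w\<close> be one of the Riemann invariants. Along its characteristics
  \<open>w' = - a v\<close>, so the suprema of both invariants do not increase; this bounds \<open>v\<close> and keeps \<open>u\<close> away
  from \<open>0\<close>. The function \<open>Y = \<surd>c w\<^sub>x + (a / 2) \<theta>(u)\<close> satisfies a Riccati equation along the same
  characteristics. Because \<open>\<mu> \<ge> 1\<close> and \<open>lam \<le> 2\<close>, its right-hand side is nonpositive, and it is at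
  most \<open>- Y\<^sup>2 / \<theta>(u)\<close> where \<open>Y \<le> 0\<close>. Hence \<open>Y\<close> is bounded above for both families, and
  \<open>\<theta>(u)\<^sub>t = \<surd>c v\<^sub>x\<close> shows that \<open>\<theta>(u)\<close> grows at most linearly in time. The hypothesis says that
  \<open>Y\<close> is negative at one initial point; from there
  \<open>(- 1 / Y)' \<le> - 1 / (C (1 + t))\<close>, and since the integral of \<open>1 / (1 + t)\<close> diverges, the solution
  cannot exist for all times.
\<close>

section \<open>Differentiation along curves and ordinary differential equations\<close>

text \<open>The mean value theorem, with derivatives taken within the interval because the solutions
  have only one-sided time derivatives at time 0.\<close>

lemma nonincreasing_if_deriv_nonpos:
  fixes f f' :: "real \<Rightarrow> real"
  assumes "a \<le> b"
    and der: "\<And>t. t \<in> {a..b} \<Longrightarrow> (f has_real_derivative f' t) (at t within {a..b})"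
    and nonpos: "\<And>t. t \<in> {a..b} \<Longrightarrow> f' t \<le> 0"
  shows "f b \<le> f a"
proof (cases "a = b")
  case False
  with \<open>a \<le> b\<close> have "a < b" by simp
  then obtain t where "t \<in> {a<..<b}" "f b - f a = f' t * (b - a)"
    using mvt_simple[of a b f "\<lambda>t. (*) (f' t)"] der
    by (auto simp: has_field_derivative_def)
  with nonpos[of t] \<open>a < b\<close> show ?thesis
    by (auto simp: mult_le_0_iff intro: diff_le_0_iff_le[THEN iffD1])
qed simp

lemma continuous_on_along_curve:
  assumes "continuous_on (S \<times> UNIV) (\<lambda>(t, x). f t x)" and "continuous_on S X"
  shows "continuous_on S (\<lambda>t. f t (X t))"
proof -
  have "continuous_on S ((\<lambda>(t, x). f t x) \<circ> (\<lambda>t. (t, X t)))"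
    by (intro continuous_on_compose continuous_on_Pair continuous_on_id assms(2)
        continuous_on_subset[OF assms(1)]) auto
  then show ?thesis by (simp add: o_def)
qed

text \<open>Joint differentiability at the point follows from the time derivative there and the
  continuity of the spatial derivative; the chain rule then applies to the curve
  \<open>(t, X t)\<close>.\<close>

lemma real_derivative_along_curve:
  fixes f fx :: "real \<Rightarrow> real \<Rightarrow> real"
  assumes ft: "((\<lambda>\<tau>. f \<tau> (X t)) has_real_derivative ft) (at t within S)"
    and fx: "\<And>\<tau> x. \<tau> \<in> S \<Longrightarrow> (f \<tau> has_real_derivative fx \<tau> x) (at x)"
    and cont: "continuous_on (S \<times> UNIV) (\<lambda>(t, x). fx t x)"
    and X: "(X has_real_derivative X') (at t within S)"
    and t: "t \<in> S"
  shows "((\<lambda>t. f t (X t)) has_real_derivative ft + fx t (X t) * X') (at t within S)"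
proof -
  define F where "F \<tau> x = blinfun_mult_right (fx \<tau> x)" for \<tau> x
  have f: "((\<lambda>(t, x). f t x) has_derivative (\<lambda>(s, y). ft * s + F t (X t) y))
      (at (t, X t) within S \<times> UNIV)"
  proof (rule has_derivative_partialsI)
    show "((\<lambda>\<tau>. f \<tau> (X t)) has_derivative (*) ft) (at t within S)"
      using ft by (simp add: has_field_derivative_def)
    show "(f \<tau> has_derivative blinfun_apply (F \<tau> x)) (at x within UNIV)" if "\<tau> \<in> S" for \<tau> x
      using fx[OF that] by (simp add: has_field_derivative_def F_def)
    have "continuous_on (S \<times> UNIV) (\<lambda>(\<tau>, x). F \<tau> x)"
      using bounded_linear.continuous_on[OF bounded_linear_blinfun_mult_right cont]
      by (simp add: F_def case_prod_unfold)
    then show "continuous (at (t, X t) within S \<times> UNIV) (\<lambda>(\<tau>, x). F \<tau> x)"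
      using t by (simp add: continuous_on_eq_continuous_within)
  qed auto
  have "((\<lambda>t. (t, X t)) has_derivative (\<lambda>h. (h, X' * h))) (at t within S)"
    using X by (auto intro!: derivative_eq_intros simp: has_field_derivative_def)
  from has_derivative_in_compose[OF this has_derivative_subset[OF f]]
  have "((\<lambda>t. f t (X t)) has_derivative (\<lambda>h. ft * h + F t (X t) (X' * h))) (at t within S)"
    by (simp add: image_subset_iff)
  moreover have "(\<lambda>h. ft * h + F t (X t) (X' * h)) = (*) (ft + fx t (X t) * X')"
    by (auto simp: F_def algebra_simps)
  ultimately show ?thesis
    by (simp add: has_field_derivative_def)
qed

text \<open>By the mean value theorem each quotient is a value of \<open>fx\<close> at distance at
  most \<open>\<bar>h n\<bar>\<close> from the curve, and \<open>fx\<close> is uniformly continuous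
  on a compact neighbourhood of the curve.\<close>

lemma uniform_limit_difference_quotient:
  fixes f fx :: "real \<Rightarrow> real \<Rightarrow> real" and h :: "nat \<Rightarrow> real"
  assumes K: "compact K"
    and fx: "\<And>t x. t \<in> K \<Longrightarrow> (f t has_real_derivative fx t x) (at x)"
    and cont: "continuous_on (K \<times> UNIV) (\<lambda>(t, x). fx t x)"
    and X: "continuous_on K X"
    and h: "h \<longlonglongrightarrow> 0" "\<And>n. h n \<noteq> 0"
  shows "uniform_limit K (\<lambda>n t. (f t (X t + h n) - f t (X t)) / h n) (\<lambda>t. fx t (X t)) sequentially"
    and "uniform_limit K (\<lambda>n t. fx t (X t + h n)) (\<lambda>t. fx t (X t)) sequentially"
proof -
  obtain B where B: "\<And>t. t \<in> K \<Longrightarrow> \<bar>X t\<bar> \<le> B"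
    using compact_imp_bounded[OF compact_continuous_image[OF X K]]
    by (auto simp: bounded_iff)
  \<comment> \<open>The curve stays in \<open>[-B, B]\<close>; the margin 1 keeps its translates
    inside as soon as \<open>\<bar>h n\<bar> < 1\<close>.\<close>
  have "uniformly_continuous_on (K \<times> {-B-1..B+1}) (\<lambda>(t, x). fx t x)"
    by (rule compact_uniformly_continuous)
       (auto intro!: compact_Times K continuous_on_subset[OF cont])
  note uc = this[unfolded uniformly_continuous_on_def, rule_format]
  have near: "\<forall>\<^sub>F n in sequentially. \<forall>t\<in>K. \<forall>x. \<bar>x - X t\<bar> \<le> \<bar>h n\<bar> \<longrightarrow> dist (fx t x) (fx t (X t)) < e"
    if "e > 0" for e
  proof -
    obtain d where d: "d > 0" and
      D: "\<And>t x y. \<lbrakk>t \<in> K; \<bar>x\<bar> \<le> B+1; \<bar>y\<bar> \<le> B+1; \<bar>x - y\<bar> < d\<rbrakk> \<Longrightarrow> dist (fx t x) (fx t y) < e"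
      using uc[OF \<open>e > 0\<close>] by (fastforce simp: abs_le_iff dist_Pair_Pair dist_real_def)
    have "\<forall>\<^sub>F n in sequentially. \<bar>h n\<bar> < min 1 d"
      using order_tendstoD(2)[OF tendsto_rabs[OF h(1)], of "min 1 d"] d by simp
    then show ?thesis
    proof (rule eventually_mono, intro ballI allI impI)
      fix n t x assume n: "\<bar>h n\<bar> < min 1 d" and "t \<in> K" and x: "\<bar>x - X t\<bar> \<le> \<bar>h n\<bar>"
      then show "dist (fx t x) (fx t (X t)) < e"
        using B[OF \<open>t \<in> K\<close>] by (intro D) auto
    qed
  qed
  show "uniform_limit K (\<lambda>n t. fx t (X t + h n)) (\<lambda>t. fx t (X t)) sequentially"
    unfolding uniform_limit_iff
    by (auto elim!: eventually_mono[OF near])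
  have mvt: "\<exists>y. \<bar>y - x\<bar> \<le> \<bar>k\<bar> \<and> (f t (x + k) - f t x) / k = fx t y"
    if "t \<in> K" "k \<noteq> 0" for t x k
  proof (cases "k > 0")
    case True
    then obtain y where "x < y" "y < x + k" "f t (x + k) - f t x = k * fx t y"
      using MVT2[of x "x + k" "f t" "fx t"] fx[OF \<open>t \<in> K\<close>] by auto
    with True show ?thesis by (intro exI[of _ y]) auto
  next
    case False
    with that have "k < 0" by simp
    then obtain y where "x + k < y" "y < x" "f t x - f t (x + k) = - k * fx t y"
      using MVT2[of "x + k" x "f t" "fx t"] fx[OF \<open>t \<in> K\<close>] by auto
    with \<open>k < 0\<close> show ?thesis by (intro exI[of _ y]) (auto simp: field_simps)
  qed
  show "uniform_limit K (\<lambda>n t. (f t (X t + h n) - f t (X t)) / h n) (\<lambda>t. fx t (X t)) sequentially"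
    unfolding uniform_limit_iff
  proof (intro allI impI)
    fix e :: real assume "e > 0"
    show "\<forall>\<^sub>F n in sequentially.
        \<forall>t\<in>K. dist ((f t (X t + h n) - f t (X t)) / h n) (fx t (X t)) < e"
      using near[OF \<open>e > 0\<close>]
    proof (rule eventually_mono, intro ballI)
      fix n t
      assume n: "\<forall>t\<in>K. \<forall>x. \<bar>x - X t\<bar> \<le> \<bar>h n\<bar> \<longrightarrow> dist (fx t x) (fx t (X t)) < e" and "t \<in> K"
      then show "dist ((f t (X t + h n) - f t (X t)) / h n) (fx t (X t)) < e"
        using mvt[OF \<open>t \<in> K\<close> h(2)[of n], of "X t"] by fastforce
    qed
  qed
qed

text \<open>
  Only one derivative of \<open>w\<close> is available. The equation is therefore not differentiated; the
  difference quotients of \<open>w\<close> between the characteristic and its translates satisfy an equation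
  whose right-hand side converges uniformly.
\<close>

lemma transport_spatial_derivative_along_characteristic:
  fixes w wx f fx g gx :: "real \<Rightarrow> real \<Rightarrow> real" and X :: "real \<Rightarrow> real"
  assumes T: "0 \<le> T"
    and wt: "\<And>t x. t \<in> {0..T} \<Longrightarrow>
      ((\<lambda>\<tau>. w \<tau> x) has_real_derivative g t x - f t x * wx t x) (at t within {0..T})"
    and wx: "\<And>t x. t \<in> {0..T} \<Longrightarrow> (w t has_real_derivative wx t x) (at x)"
    and gx: "\<And>t x. t \<in> {0..T} \<Longrightarrow> (g t has_real_derivative gx t x) (at x)"
    and fx: "\<And>t x. t \<in> {0..T} \<Longrightarrow> (f t has_real_derivative fx t x) (at x)"
    and cont_wx: "continuous_on ({0..T} \<times> UNIV) (\<lambda>(t, x). wx t x)"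
    and cont_gx: "continuous_on ({0..T} \<times> UNIV) (\<lambda>(t, x). gx t x)"
    and cont_fx: "continuous_on ({0..T} \<times> UNIV) (\<lambda>(t, x). fx t x)"
    and X: "\<And>t. t \<in> {0..T} \<Longrightarrow> (X has_real_derivative f t (X t)) (at t within {0..T})"
    and t: "t \<in> {0..T}"
  shows "((\<lambda>t. wx t (X t)) has_real_derivative gx t (X t) - fx t (X t) * wx t (X t))
    (at t within {0..T})"
proof -
  define h where "h n = inverse (real (Suc n))" for n
  have h: "h \<longlonglongrightarrow> 0" "\<And>n. h n \<noteq> 0"
    unfolding h_def using LIMSEQ_inverse_real_of_nat by auto
  have contX: "continuous_on {0..T} X"
    using X by (rule DERIV_continuous_on)
  define F where "F n t = (w t (X t + h n) - w t (X t)) / h n" for n t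
  define F' where "F' n t = (g t (X t + h n) - g t (X t)) / h n
      - (f t (X t + h n) - f t (X t)) / h n * wx t (X t + h n)" for n t
  have F: "(F n has_real_derivative F' n t) (at t within {0..T})" if "t \<in> {0..T}" for n t
  proof -
    \<comment> \<open>The translated curve still moves with the speed at \<open>X t\<close>. The
      mismatch with \<open>f t (X t + h n)\<close> produces the second quotient in
      \<open>F'\<close>.\<close>
    have "((\<lambda>t. w t (X t + h n)) has_real_derivative
        (g t (X t + h n) - f t (X t + h n) * wx t (X t + h n)) + wx t (X t + h n) * f t (X t))
        (at t within {0..T})"
      by (rule real_derivative_along_curve[where X = "\<lambda>t. X t + h n"])
         (use that in \<open>auto intro!: wt wx cont_wx derivative_eq_intros X\<close>)
    moreover have "((\<lambda>t. w t (X t)) has_real_derivative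
        (g t (X t) - f t (X t) * wx t (X t)) + wx t (X t) * f t (X t)) (at t within {0..T})"
      by (rule real_derivative_along_curve) (use that in \<open>auto intro!: wt wx cont_wx X\<close>)
    ultimately have "((\<lambda>t. (w t (X t + h n) - w t (X t)) / h n) has_real_derivative
       (((g t (X t + h n) - f t (X t + h n) * wx t (X t + h n)) + wx t (X t + h n) * f t (X t))
       - ((g t (X t) - f t (X t) * wx t (X t)) + wx t (X t) * f t (X t))) / h n)
       (at t within {0..T})"
      by (intro DERIV_cdivide DERIV_diff)
    moreover have "(((g t (X t + h n) - f t (X t + h n) * wx t (X t + h n)) + wx t (X t + h n) * f t (X t))
       - ((g t (X t) - f t (X t) * wx t (X t)) + wx t (X t) * f t (X t))) / h n = F' n t"
      using h(2)[of n] by (simp add: F'_def field_simps)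
    ultimately show ?thesis by (simp add: F_def[abs_def])
  qed
  \<comment> \<open>A product of uniformly convergent sequences converges uniformly if the limits
    are bounded.\<close>
  have bdd: "bounded ((\<lambda>t. fx t (X t)) ` {0..T})" "bounded ((\<lambda>t. wx t (X t)) ` {0..T})"
    by (intro compact_imp_bounded compact_continuous_image compact_Icc
        continuous_on_along_curve[OF cont_fx contX] continuous_on_along_curve[OF cont_wx contX])+
  have "uniform_limit {0..T} F' (\<lambda>t. gx t (X t) - fx t (X t) * wx t (X t)) sequentially"
    unfolding F'_def
    by (intro uniform_limit_minus uniform_lim_mult bdd
        uniform_limit_difference_quotient[OF _ gx cont_gx contX h]
        uniform_limit_difference_quotient(1)[OF _ fx cont_fx contX h]
        uniform_limit_difference_quotient(2)[OF _ wx cont_wx contX h]) auto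
  then have lim': "\<forall>\<^sub>F n in sequentially. \<forall>t\<in>{0..T}. \<forall>k.
      norm (F' n t * k - (gx t (X t) - fx t (X t) * wx t (X t)) * k) \<le> e * norm k"
    if "e > 0" for e
    using that unfolding uniform_limit_iff
    by (auto elim!: allE[of _ e] eventually_mono intro!: mult_right_mono
        simp: dist_real_def abs_mult left_diff_distrib[symmetric] less_imp_le)
  have lim: "(\<lambda>n. F n t) \<longlonglongrightarrow> wx t (X t)" if "t \<in> {0..T}" for t
    using tendsto_uniform_limitI[OF
        uniform_limit_difference_quotient(1)[OF _ wx cont_wx contX h] that]
    by (simp add: F_def)
  \<comment> \<open>Uniform convergence of the derivatives and convergence at time 0 give a
    differentiable limit, whose derivative is the limit of the \<open>F' n\<close>.\<close>
  have "\<exists>q. \<forall>t\<in>{0..T}. (\<lambda>n. F n t) \<longlonglongrightarrow> q t \<and>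
      (q has_derivative (*) (gx t (X t) - fx t (X t) * wx t (X t))) (at t within {0..T})"
    by (rule has_derivative_sequence[where f' = "\<lambda>n t. (*) (F' n t)" and ?x0.0 = 0])
       (use F lim' lim[of 0] T in \<open>auto simp: has_field_derivative_def\<close>)
  then obtain q where q: "\<And>t. t \<in> {0..T} \<Longrightarrow> (\<lambda>n. F n t) \<longlonglongrightarrow> q t"
    "\<And>t. t \<in> {0..T} \<Longrightarrow>
      (q has_derivative (*) (gx t (X t) - fx t (X t) * wx t (X t))) (at t within {0..T})"
    by blast
  have "q t = wx t (X t)" if "t \<in> {0..T}" for t
    using q(1)[OF that] lim[OF that] LIMSEQ_unique by blast
  then show ?thesis
    using q(2)[OF t] t unfolding has_field_derivative_def
    by (metis (no_types, lifting) has_derivative_transform)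
qed

text \<open>The weight \<open>exp (-2 L t)\<close> makes the Picard operator a contraction on all of \<open>[0, T]\<close>.\<close>

lemma Lipschitz_ode_solution_exists:
  fixes f :: "real \<Rightarrow> real \<Rightarrow> real"
  assumes T: "0 \<le> T"
    and cont: "continuous_on ({0..T} \<times> UNIV) (\<lambda>(t, x). f t x)"
    and lip: "\<And>t x y. t \<in> {0..T} \<Longrightarrow> \<bar>f t x - f t y\<bar> \<le> L * \<bar>x - y\<bar>"
    and L: "0 \<le> L"
  obtains X where "X 0 = x0"
    and "\<And>t. t \<in> {0..T} \<Longrightarrow> (X has_real_derivative f t (X t)) (at t within {0..T})"
proof -
  \<comment> \<open>The solution is sought as \<open>X t = x0 + exp (2 * L * t) * y t\<close>;
    \<open>G\<close> is the Picard operator written for \<open>y\<close>.\<close>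
  define G where "G y t = exp (- (2 * L * t)) * integral {0..t} (\<lambda>s. f s (x0 + exp (2 * L * s) * y s))"
    for y :: "real \<Rightarrow>\<^sub>C real" and t
  \<comment> \<open>Clipping the time to \<open>[0, T]\<close> turns \<open>G y\<close> into a
    bounded continuous function on the whole line; these form the complete space in which Banach's
    fixed point theorem is applied.\<close>
  define clip where "clip t = max 0 (min T t)" for t
  have clip: "clip t \<in> {0..T}" for t using T by (auto simp: clip_def)
  have contf: "continuous_on {0..T} (\<lambda>s. f s (x0 + exp (2 * L * s) * y s))" for y :: "real \<Rightarrow>\<^sub>C real"
    by (intro continuous_on_along_curve[OF cont] continuous_intros continuous_on_apply_bcontfun)
  have intf: "(\<lambda>s. f s (x0 + exp (2 * L * s) * y s)) integrable_on {0..t}"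
    if "t \<le> T" for t and y :: "real \<Rightarrow>\<^sub>C real"
    using that by (auto intro!: integrable_continuous_interval continuous_on_subset[OF contf])
  have contG: "continuous_on {0..T} (G y)" for y
    unfolding G_def
    by (intro continuous_intros indefinite_integral_continuous_1 intf order_refl)
  define P where "P y = Bcontfun (\<lambda>t. G y (clip t))" for y
  have "(\<lambda>t. G y (clip t)) \<in> bcontfun" for y
  proof -
    have "continuous_on UNIV (\<lambda>t. G y (clip t))"
      using clip by (intro continuous_on_compose2[OF contG, of _ clip])
        (auto simp: clip_def intro!: continuous_intros)
    moreover have "bounded (G y ` {0..T})"
      by (intro compact_imp_bounded compact_continuous_image contG) simp
    then have "bounded (range (\<lambda>t. G y (clip t)))"
      using clip by (auto elim!: bounded_subset)
    ultimately show ?thesis by (simp add: bcontfun_def)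
  qed
  then have P: "apply_bcontfun (P y) t = G y (clip t)" for y t
    by (simp add: P_def Bcontfun_inverse)
  have "dist (P y) (P z) \<le> 1 / 2 * dist y z" for y z
  proof (rule dist_bound)
    fix t
    define r where "r = clip t"
    define D where "D = dist y z"
    have r: "0 \<le> r" "r \<le> T" using clip[of t] by (auto simp: r_def)
    have D: "0 \<le> D" "\<And>s. \<bar>y s - z s\<bar> \<le> D"
      using dist_bounded[of y _ z] by (auto simp: D_def dist_real_def)
    have I: "((\<lambda>s. L * (exp (2 * L * s) * D)) has_integral
        exp (2 * L * r) * D / 2 - exp (2 * L * 0) * D / 2) {0..r}"
      using r by (intro fundamental_theorem_of_calculus)
        (auto intro!: derivative_eq_intros
          simp flip: has_real_derivative_iff_has_vector_derivative)
    have le: "norm (f s (x0 + exp (2 * L * s) * y s) - f s (x0 + exp (2 * L * s) * z s))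
        \<le> L * (exp (2 * L * s) * D)" if "s \<in> {0..r}" for s
    proof -
      have "\<bar>f s (x0 + exp (2 * L * s) * y s) - f s (x0 + exp (2 * L * s) * z s)\<bar>
          \<le> L * \<bar>exp (2 * L * s) * (y s - z s)\<bar>"
        using lip[of s "x0 + exp (2 * L * s) * y s" "x0 + exp (2 * L * s) * z s"] that r
        by (simp add: algebra_simps)
      also have "\<dots> \<le> L * (exp (2 * L * s) * D)"
        using D L by (intro mult_left_mono) (auto simp: abs_mult)
      finally show ?thesis by simp
    qed
    have "G y r - G z r = exp (- (2 * L * r)) * integral {0..r}
        (\<lambda>s. f s (x0 + exp (2 * L * s) * y s) - f s (x0 + exp (2 * L * s) * z s))"
      using intf r by (simp add: G_def integral_diff right_diff_distrib)
    then have "\<bar>G y r - G z r\<bar> = exp (- (2 * L * r)) * norm (integral {0..r}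
        (\<lambda>s. f s (x0 + exp (2 * L * s) * y s) - f s (x0 + exp (2 * L * s) * z s)))"
      by (simp add: abs_mult)
    also have "\<dots> \<le> exp (- (2 * L * r)) * integral {0..r} (\<lambda>s. L * (exp (2 * L * s) * D))"
      by (intro mult_left_mono integral_norm_bound_integral[OF
            integrable_diff[OF intf[OF r(2), of y] intf[OF r(2), of z]]
            has_integral_integrable[OF I] le]) simp_all
    also have "\<dots> = exp (- (2 * L * r)) * (exp (2 * L * r) * D / 2 - exp (2 * L * 0) * D / 2)"
      by (simp only: integral_unique[OF I])
    also have "\<dots> = (1 - exp (- (2 * L * r))) * (D / 2)"
      by (simp add: algebra_simps flip: exp_add)
    also have "\<dots> \<le> 1 / 2 * D"
      using D by (simp add: mult_left_le_one_le algebra_simps)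
    finally show "dist (P y t) (P z t) \<le> 1 / 2 * dist y z"
      by (simp add: P r_def D_def dist_real_def)
  qed
  then obtain y where y: "P y = y"
    using banach_fix_type[of "1 / 2" P] by auto
  define X where "X t = x0 + exp (2 * L * t) * y t" for t
  have X: "X t = x0 + integral {0..t} (\<lambda>s. f s (X s))" if "t \<in> {0..T}" for t
  proof -
    have "y t = G y t"
      using that P[of y t] y by (simp add: clip_def)
    then show ?thesis by (simp add: X_def G_def mult.assoc[symmetric] flip: exp_add)
  qed
  show ?thesis
  proof
    show "X 0 = x0" using X[of 0] T by simp
    fix t assume t: "t \<in> {0..T}"
    have "((\<lambda>t. x0 + integral {0..t} (\<lambda>s. f s (X s))) has_real_derivative f t (X t))
        (at t within {0..T})"
      using integral_has_real_derivative[OF contf t, of y]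
      by (auto intro!: derivative_eq_intros simp: X_def)
    then show "(X has_real_derivative f t (X t)) (at t within {0..T})"
      unfolding has_field_derivative_def by - (rule has_derivative_transform[OF t], rule X, assumption+)
  qed
qed

text \<open>Reversing time, \<open>t\<close> to \<open>T - t\<close>, turns the terminal condition
  into an initial one.\<close>

lemma Lipschitz_ode_terminal_solution_exists:
  fixes f :: "real \<Rightarrow> real \<Rightarrow> real"
  assumes T: "0 \<le> T"
    and cont: "continuous_on ({0..T} \<times> UNIV) (\<lambda>(t, x). f t x)"
    and lip: "\<And>t x y. t \<in> {0..T} \<Longrightarrow> \<bar>f t x - f t y\<bar> \<le> L * \<bar>x - y\<bar>"
    and L: "0 \<le> L"
  obtains X where "X T = x0"
    and "\<And>t. t \<in> {0..T} \<Longrightarrow> (X has_real_derivative f t (X t)) (at t within {0..T})"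
proof -
  have "continuous_on ({0..T} \<times> UNIV) (\<lambda>(t, x). - f (T - t) x)"
    unfolding case_prod_unfold
    by (intro continuous_on_minus continuous_on_compose2[OF cont, of "{0..T} \<times> UNIV"
          "\<lambda>p. (T - fst p, snd p)", unfolded prod.case])
       (auto intro!: continuous_intros)
  moreover have "\<bar>- f (T - t) x - - f (T - t) y\<bar> \<le> L * \<bar>x - y\<bar>" if "t \<in> {0..T}" for t x y
    using lip[of "T - t" x y] that by simp
  ultimately obtain Z where Z: "Z 0 = x0"
    "\<And>t. t \<in> {0..T} \<Longrightarrow> (Z has_real_derivative - f (T - t) (Z t)) (at t within {0..T})"
    using Lipschitz_ode_solution_exists[OF T, of "\<lambda>t x. - f (T - t) x" L x0] L by blast
  show ?thesis
  proof (rule that[of "\<lambda>t. Z (T - t)"])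
    show "Z (T - T) = x0" using Z by simp
    fix t assume t: "t \<in> {0..T}"
    have img: "(\<lambda>t. T - t) ` {0..T} = {0..T}" by (auto intro!: image_eqI[of _ _ "T - _"])
    have "(Z \<circ> (\<lambda>t. T - t) has_real_derivative - f (T - (T - t)) (Z (T - t)) * - 1) (at t within {0..T})"
      by (rule DERIV_image_chain) (use t Z(2)[of "T - t"] in \<open>auto simp: img intro!: derivative_eq_intros\<close>)
    then show "((\<lambda>t. Z (T - t)) has_real_derivative f t (Z (T - t))) (at t within {0..T})"
      by (simp add: o_def)
  qed
qed

section \<open>The gas law and the damping coefficient\<close>

definition damping :: "real \<Rightarrow> real \<Rightarrow> real \<Rightarrow> real" where
  "damping \<mu> lam t = lam / (1 + t) powr \<mu>"

text \<open>The closed form of the square root of the wave speed for positive \<open>w\<close>. It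
  is also the derivative of \<open>theta\<close>.\<close>

definition root_speed :: "real \<Rightarrow> real \<Rightarrow> real" where
  "root_speed \<gamma> w = w powr (- ((\<gamma> + 1) / 4))"

definition root_speed_deriv :: "real \<Rightarrow> real \<Rightarrow> real" where
  "root_speed_deriv \<gamma> w = - ((\<gamma> + 1) / 4) * w powr (- ((\<gamma> + 5) / 4))"

lemma root_speed_pos: "w > 0 \<Longrightarrow> root_speed \<gamma> w > 0"
  by (simp add: root_speed_def)

lemma root_speed_square: "(root_speed \<gamma> w)\<^sup>2 = w powr (- ((\<gamma> + 1) / 2))"
proof -
  have "- ((\<gamma> + 1) / 4) + - ((\<gamma> + 1) / 4) = - ((\<gamma> + 1) / 2)" by simp
  then show ?thesis
    by (simp only: root_speed_def power2_eq_square flip: powr_add)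
qed

lemma sqrt_wave_speed:
  assumes "\<gamma> > 0" "w > 0"
  shows "sqrt (wave_speed \<gamma> w) = root_speed \<gamma> w"
  using real_sqrt_unique[OF root_speed_square, of \<gamma> w] root_speed_pos[of w \<gamma>] assms
  by (simp add: wave_speed_eq)

lemma has_derivative_root_speed:
  assumes "w > 0"
  shows "(root_speed \<gamma> has_real_derivative root_speed_deriv \<gamma> w) (at w)"
proof -
  have "- ((\<gamma> + 1) / 4) - 1 = - ((\<gamma> + 5) / 4)" by (simp add: field_simps)
  then show ?thesis
    using has_real_derivative_powr[OF assms, of "- ((\<gamma> + 1) / 4)"]
    by (simp only: root_speed_def[abs_def] root_speed_deriv_def)
qed

lemma theta_pos: "\<gamma> < 3 \<Longrightarrow> w > 0 \<Longrightarrow> theta \<gamma> w > 0"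
  by (simp add: theta_def)

lemma has_derivative_theta:
  assumes "\<gamma> < 3" "w > 0"
  shows "(theta \<gamma> has_real_derivative root_speed \<gamma> w) (at w)"
proof -
  have "(3 - \<gamma>) / 4 - 1 = - ((\<gamma> + 1) / 4)" by (simp add: field_simps)
  moreover have "4 / (3 - \<gamma>) * ((3 - \<gamma>) / 4 * z) = z" for z using assms by simp
  ultimately show ?thesis
    using DERIV_cmult[OF has_real_derivative_powr[OF assms(2), of "(3 - \<gamma>) / 4"], of "4 / (3 - \<gamma>)"]
    by (simp only: theta_def[abs_def] root_speed_def)
qed

text \<open>The exponents satisfy \<open>- (\<gamma> + 5) / 4 + (3 - \<gamma>) / 4 = - (\<gamma> +
  1) / 2\<close>. In this form the derivative becomes the coefficient of the quadratic term of the
  Riccati equation.\<close>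

lemma root_speed_deriv_eq:
  assumes "\<gamma> < 3" "w > 0"
  shows "root_speed_deriv \<gamma> w = - ((\<gamma> + 1) / (3 - \<gamma>) * (root_speed \<gamma> w)\<^sup>2 / theta \<gamma> w)"
proof -
  have "w powr (- ((\<gamma> + 5) / 4)) * w powr ((3 - \<gamma>) / 4) = w powr (- ((\<gamma> + 1) / 2))"
    unfolding powr_add[symmetric] by (rule arg_cong) (simp add: field_simps)
  then have *: "root_speed_deriv \<gamma> w * theta \<gamma> w = - ((\<gamma> + 1) / (3 - \<gamma>) * (root_speed \<gamma> w)\<^sup>2)"
    using assms by (simp add: root_speed_deriv_def theta_def root_speed_square)
  then show ?thesis
    using theta_pos[OF assms] unfolding minus_divide_left
    by (subst nonzero_eq_divide_eq) (simp_all only: * order_less_imp_not_eq2 not_False_eq_True simp_thms)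
qed

lemma has_derivative_eta:
  assumes "\<gamma> > 1" "w > 0"
  shows "(eta \<gamma> has_real_derivative - (root_speed \<gamma> w)\<^sup>2) (at w)"
proof -
  have "- ((\<gamma> - 1) / 2) - 1 = - ((\<gamma> + 1) / 2)" by (simp add: field_simps)
  moreover have "2 / (\<gamma> - 1) * (- ((\<gamma> - 1) / 2) * z) = - z" for z using assms by simp
  ultimately have "((\<lambda>w. 2 / (\<gamma> - 1) * w powr (- ((\<gamma> - 1) / 2))) has_real_derivative
      - (root_speed \<gamma> w)\<^sup>2) (at w)"
    using DERIV_cmult[OF has_real_derivative_powr[OF assms(2), of "- ((\<gamma> - 1) / 2)"], of "2 / (\<gamma> - 1)"]
    by (simp only: root_speed_square)
  \<comment> \<open>The closed form of \<open>eta\<close> is available for positive arguments; they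
    form an open set, so the derivative carries over.\<close>
  then show ?thesis
    by (rule has_field_derivative_transform_within_open[of _ _ _ "{0<..}"])
       (use assms in \<open>auto simp: eta_eq\<close>)
qed

lemma eta_pos: "\<gamma> > 1 \<Longrightarrow> w > 0 \<Longrightarrow> eta \<gamma> w > 0"
  by (simp add: eta_eq)

lemma eta_antimono:
  assumes "\<gamma> > 1" "0 < w" "w \<le> z"
  shows "eta \<gamma> z \<le> eta \<gamma> w"
  using assms by (auto simp: eta_eq intro!: divide_right_mono powr_mono2')

lemma has_derivative_pressure:
  assumes "\<gamma> > 0" "w > 0"
  shows "(pressure \<gamma> has_real_derivative - (root_speed \<gamma> w ^ 4)) (at w)"
proof -
  have "w powr (- ((\<gamma> + 1) / 2)) * w powr (- ((\<gamma> + 1) / 2)) = w powr (- \<gamma> - 1)"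
    unfolding powr_add[symmetric] by (rule arg_cong) (simp add: field_simps)
  then have "(root_speed \<gamma> w) ^ 4 = w powr (- \<gamma> - 1)"
    unfolding root_speed_square[symmetric] by (simp add: power2_eq_square power4_eq_xxxx)
  then show ?thesis
    using assms unfolding pressure_def[abs_def]
    by (auto intro!: derivative_eq_intros)
qed

section \<open>The damping coefficient and the Riccati right-hand side\<close>

lemma damping_at_0: "damping \<mu> lam 0 = lam"
  by (simp add: damping_def)

lemma damping_nonneg: "0 \<le> lam \<Longrightarrow> 0 \<le> damping \<mu> lam t"
  by (simp add: damping_def)

lemma damping_le:
  assumes "0 \<le> lam" "\<mu> \<ge> 0" "t \<ge> 0"
  shows "damping \<mu> lam t \<le> lam"
proof -
  have "1 \<le> (1 + t) powr \<mu>" using assms by (intro ge_one_powr_ge_zero) auto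
  then show ?thesis using assms by (simp add: damping_def divide_le_eq mult_left_le mult_le_cancel_left1)
qed

lemma has_derivative_damping:
  assumes "t \<ge> 0"
  shows "(damping \<mu> lam has_real_derivative - (\<mu> * damping \<mu> lam t / (1 + t))) (at t)"
proof -
  have "damping \<mu> lam = (\<lambda>t. lam * (1 + t) powr (- \<mu>))"
    by (auto simp: damping_def powr_minus field_simps)
  moreover have "((\<lambda>t. lam * (1 + t) powr (- \<mu>)) has_real_derivative
      lam * (- \<mu> * (1 + t) powr (- \<mu> - 1))) (at t)"
    using assms by (auto intro!: derivative_eq_intros)
  moreover have "(1 + t) powr (- \<mu> - 1) = (1 + t) powr (- \<mu>) / (1 + t)"
    using assms by (simp add: powr_diff)
  ultimately show ?thesis by (simp add: field_simps)
qed

text \<open>This is where \<open>\<mu> \<ge> 1\<close> and \<open>lam \<le> 2\<close> enter: the term linear in \<open>theta\<close> has a sign.\<close>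

lemma damping_square_le:
  assumes "0 \<le> lam" "lam \<le> 2" "\<mu> \<ge> 1" "t \<ge> 0"
  shows "(damping \<mu> lam t)\<^sup>2 \<le> 2 * (\<mu> * damping \<mu> lam t / (1 + t))"
proof -
  have "(1 + t) powr 1 \<le> (1 + t) powr \<mu>"
    using assms by (intro powr_mono) auto
  then have "damping \<mu> lam t \<le> 2 / (1 + t)"
    using assms unfolding damping_def by (intro frac_le) auto
  also have "\<dots> \<le> 2 * \<mu> / (1 + t)"
    using assms by (intro divide_right_mono) auto
  finally have "damping \<mu> lam t * damping \<mu> lam t \<le> 2 * \<mu> / (1 + t) * damping \<mu> lam t"
    using assms by (intro mult_right_mono damping_nonneg) auto
  then show ?thesis by (simp add: power2_eq_square algebra_simps)
qed

text \<open>With \<open>p = a / 2 * \<theta>\<close> the assumption on \<open>a'\<close> gives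
  \<open>E \<le> - (y\<^sup>2 + p * y + p\<^sup>2) / \<theta>\<close>, and this quadratic form is
  nonnegative. If \<open>y + p \<le> 0\<close>, then \<open>p * y \<le> 0\<close>, so the form is at
  least \<open>(y + p)\<^sup>2\<close>. In the application \<open>y + p\<close> is the function
  \<open>Y\<close>, and \<open>a'\<close> is the time derivative of the damping.\<close>

lemma riccati_rhs_bounds:
  fixes K y a a' \<theta> :: real
  assumes "K \<ge> 1" "\<theta> > 0" "a \<ge> 0" "a\<^sup>2 \<le> - 2 * a'"
  defines "E \<equiv> - (K * y\<^sup>2 / \<theta>) - a / 2 * y + a' / 2 * \<theta>"
  shows "E \<le> 0" and "y + a / 2 * \<theta> \<le> 0 \<Longrightarrow> E \<le> - ((y + a / 2 * \<theta>)\<^sup>2 / \<theta>)"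
proof -
  define p where "p = a / 2 * \<theta>"
  have p: "p \<ge> 0" using assms by (simp add: p_def)
  have "a' / 2 * \<theta> \<le> - (p\<^sup>2 / \<theta>)"
    using assms mult_right_mono[of "a\<^sup>2" "- 2 * a'" \<theta>]
    by (simp add: p_def power2_eq_square field_simps)
  moreover have "y\<^sup>2 / \<theta> \<le> K * y\<^sup>2 / \<theta>"
    using assms mult_right_mono[of 1 K "y\<^sup>2"] by (intro divide_right_mono) auto
  moreover have "a / 2 * y = p * y / \<theta>" using assms by (simp add: p_def)
  ultimately have E: "E \<le> - ((y\<^sup>2 + p * y + p\<^sup>2) / \<theta>)"
    unfolding E_def add_divide_distrib by linarith
  have "y\<^sup>2 + p * y + p\<^sup>2 = (y + p / 2)\<^sup>2 + 3 / 4 * p\<^sup>2"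
    by (simp add: power2_eq_square algebra_simps)
  also have "\<dots> \<ge> 0" by simp
  finally have "0 \<le> (y\<^sup>2 + p * y + p\<^sup>2) / \<theta>" using assms(2) by simp
  with E show "E \<le> 0" by linarith
  assume "y + a / 2 * \<theta> \<le> 0"
  then have "y \<le> 0" using p by (simp only: p_def)
  then have "p * y \<le> 0" using p by (simp add: mult_nonneg_nonpos)
  then have "(y + p)\<^sup>2 \<le> y\<^sup>2 + p * y + p\<^sup>2"
    by (simp add: power2_eq_square algebra_simps)
  then have "(y + p)\<^sup>2 / \<theta> \<le> (y\<^sup>2 + p * y + p\<^sup>2) / \<theta>"
    using assms by (intro divide_right_mono) auto
  with E show "E \<le> - ((y + a / 2 * \<theta>)\<^sup>2 / \<theta>)" by (simp add: p_def)
qed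

section \<open>Riemann invariants along characteristics\<close>

text \<open>The bounds \<open>b\<close> and \<open>d\<close> may depend on \<open>T\<close>. They
  provide positivity of \<open>u\<close>, Lipschitz characteristic speeds and finite suprema, but do
  not enter the estimates \<open>riem_le_initial\<close>, \<open>theta_le\<close> and
  \<open>lifespan_bound\<close>, which therefore are uniform up to the lifespan.\<close>

locale damped_flow =
  fixes \<gamma> \<mu> lam T b d :: real and u v ux vx :: "real \<Rightarrow> real \<Rightarrow> real"
  assumes \<gamma>: "1 < \<gamma>" "\<gamma> < 3" and \<mu>: "1 \<le> \<mu>" and lam: "0 \<le> lam" "lam \<le> 2"
    and T: "0 \<le> T" and d: "0 < d"
    and ut: "\<And>t x. t \<in> {0..T} \<Longrightarrow> ((\<lambda>\<tau>. u \<tau> x) has_real_derivative vx t x) (at t within {0..T})"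
    and vt: "\<And>t x. t \<in> {0..T} \<Longrightarrow> ((\<lambda>\<tau>. v \<tau> x) has_real_derivative
      root_speed \<gamma> (u t x) ^ 4 * ux t x - damping \<mu> lam t * v t x) (at t within {0..T})"
    and ux: "\<And>t x. t \<in> {0..T} \<Longrightarrow> (u t has_real_derivative ux t x) (at x)"
    and vx: "\<And>t x. t \<in> {0..T} \<Longrightarrow> (v t has_real_derivative vx t x) (at x)"
    and cont_u: "continuous_on ({0..T} \<times> UNIV) (\<lambda>(t, x). u t x)"
    and cont_ux: "continuous_on ({0..T} \<times> UNIV) (\<lambda>(t, x). ux t x)"
    and cont_vx: "continuous_on ({0..T} \<times> UNIV) (\<lambda>(t, x). vx t x)"
    and u_ge: "\<And>t x. t \<in> {0..T} \<Longrightarrow> d \<le> u t x"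
    and v_bound: "\<And>t x. t \<in> {0..T} \<Longrightarrow> \<bar>v t x\<bar> \<le> b"
    and ux_bound: "\<And>t x. t \<in> {0..T} \<Longrightarrow> \<bar>ux t x\<bar> \<le> b"
begin

lemma u_pos: "t \<in> {0..T} \<Longrightarrow> 0 < u t x"
  using u_ge d by (meson less_le_trans)

lemma b_nonneg: "0 \<le> b"
  using v_bound[of 0 0] T by simp

text \<open>Makes any \<open>t\<close> the terminal time, so that characteristics can be traced back
  to time 0 from every point of the strip.\<close>

lemma restrict:
  assumes "t \<in> {0..T}"
  shows "damped_flow \<gamma> \<mu> lam t b d u v ux vx"
proof
  fix \<tau> x assume "\<tau> \<in> {0..t}"
  with assms have \<tau>: "\<tau> \<in> {0..T}" "{0..t} \<subseteq> {0..T}" by auto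
  show "((\<lambda>\<tau>. u \<tau> x) has_real_derivative vx \<tau> x) (at \<tau> within {0..t})"
    "((\<lambda>\<tau>. v \<tau> x) has_real_derivative
      root_speed \<gamma> (u \<tau> x) ^ 4 * ux \<tau> x - damping \<mu> lam \<tau> * v \<tau> x) (at \<tau> within {0..t})"
    using ut[OF \<tau>(1)] vt[OF \<tau>(1)] \<tau>(2) by (meson DERIV_subset)+
  show "(u \<tau> has_real_derivative ux \<tau> x) (at x)" "(v \<tau> has_real_derivative vx \<tau> x) (at x)"
    "d \<le> u \<tau> x" "\<bar>v \<tau> x\<bar> \<le> b" "\<bar>ux \<tau> x\<bar> \<le> b"
    using ux vx u_ge v_bound ux_bound \<tau> by auto
next
  have "{0..t} \<times> UNIV \<subseteq> {0..T} \<times> (UNIV :: real set)" using assms by auto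
  then show "continuous_on ({0..t} \<times> UNIV) (\<lambda>(t, x). u t x)"
    "continuous_on ({0..t} \<times> UNIV) (\<lambda>(t, x). ux t x)"
    "continuous_on ({0..t} \<times> UNIV) (\<lambda>(t, x). vx t x)"
    using cont_u cont_ux cont_vx by (meson continuous_on_subset)+
qed (use assms \<gamma> \<mu> lam d in auto)

text \<open>
  The sign \<open>s \<in> {1, -1}\<close> selects the Riemann invariant: \<open>s = 1\<close> gives \<open>r\<close>, which is transported
  with speed \<open>- c\<close>, and \<open>s = -1\<close> gives the other invariant, transported with speed \<open>c\<close>.
\<close>

definition riem :: "real \<Rightarrow> real \<Rightarrow> real \<Rightarrow> real" where
  "riem s t x = v t x - s * eta \<gamma> (u t x)"

definition riem_x :: "real \<Rightarrow> real \<Rightarrow> real \<Rightarrow> real" where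
  "riem_x s t x = vx t x + s * (root_speed \<gamma> (u t x))\<^sup>2 * ux t x"

definition speed :: "real \<Rightarrow> real \<Rightarrow> real \<Rightarrow> real" where
  "speed s t x = - s * (root_speed \<gamma> (u t x))\<^sup>2"

definition speed_x :: "real \<Rightarrow> real \<Rightarrow> real \<Rightarrow> real" where
  "speed_x s t x = - s * (2 * root_speed \<gamma> (u t x) * root_speed_deriv \<gamma> (u t x) * ux t x)"

definition characteristic :: "real \<Rightarrow> (real \<Rightarrow> real) \<Rightarrow> bool" where
  "characteristic s X \<longleftrightarrow>
    (\<forall>t\<in>{0..T}. (X has_real_derivative speed s t (X t)) (at t within {0..T}))"

text \<open>The factor \<open>root_speed\<close> removes the product of the two spatial derivatives
  from the equation for \<open>riem_x s\<close>; the \<open>theta\<close> term removes the part of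
  the damping that contains \<open>riem_x (- s)\<close>. What remains is a Riccati equation for one
  family.\<close>

definition weighted :: "real \<Rightarrow> real \<Rightarrow> real \<Rightarrow> real" where
  "weighted s t x = root_speed \<gamma> (u t x) * riem_x s t x + damping \<mu> lam t / 2 * theta \<gamma> (u t x)"

lemma v_eq: "v t x = (riem s t x + riem (- s) t x) / 2"
  by (simp add: riem_def)

lemma riem_has_derivative_x:
  assumes "t \<in> {0..T}"
  shows "(riem s t has_real_derivative riem_x s t x) (at x)"
  using DERIV_diff[OF vx[OF assms]
      DERIV_cmult[OF DERIV_chain2[OF has_derivative_eta[OF \<gamma>(1) u_pos[OF assms]] ux[OF assms]]]]
  by (simp add: riem_def[abs_def] riem_x_def algebra_simps)

text \<open>The diagonal form of the system. Both equations combine into one transport equation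
  because \<open>s * s = 1\<close>.\<close>

lemma riem_has_derivative_t:
  assumes "t \<in> {0..T}" and "s \<in> {1, -1}"
  shows "((\<lambda>\<tau>. riem s \<tau> x) has_real_derivative
    - damping \<mu> lam t * v t x - speed s t x * riem_x s t x) (at t within {0..T})"
proof -
  have d: "((\<lambda>\<tau>. riem s \<tau> x) has_real_derivative
      (root_speed \<gamma> (u t x) ^ 4 * ux t x - damping \<mu> lam t * v t x)
      - s * (- (root_speed \<gamma> (u t x))\<^sup>2 * vx t x)) (at t within {0..T})"
    unfolding riem_def
    by (rule DERIV_diff[OF vt[OF assms(1)] DERIV_cmult[OF
          DERIV_chain2[OF has_derivative_eta[OF \<gamma>(1) u_pos[OF assms(1)]] ut[OF assms(1)]]]])
  show ?thesis
    by (rule DERIV_cong[OF d])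
       (use assms(2) in \<open>auto simp: riem_x_def speed_def power2_eq_square power4_eq_xxxx algebra_simps\<close>)
qed

lemma speed_has_derivative_x:
  assumes "t \<in> {0..T}"
  shows "(speed s t has_real_derivative speed_x s t x) (at x)"
  using DERIV_cmult[OF DERIV_power[OF
        DERIV_chain2[OF has_derivative_root_speed[OF u_pos[OF assms]] ux[OF assms]], where n = 2], of "- s"]
  by (simp add: speed_def[abs_def] speed_x_def algebra_simps)

lemma
  shows continuous_riem_x: "continuous_on ({0..T} \<times> UNIV) (\<lambda>(t, x). riem_x s t x)"
    and continuous_speed: "continuous_on ({0..T} \<times> UNIV) (\<lambda>(t, x). speed s t x)"
    and continuous_speed_x: "continuous_on ({0..T} \<times> UNIV) (\<lambda>(t, x). speed_x s t x)"
proof -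
  have "\<forall>p\<in>{0..T} \<times> UNIV. u (fst p) (snd p) \<noteq> 0"
    using u_pos by (auto simp: less_imp_neq[symmetric])
  then have R: "continuous_on ({0..T} \<times> UNIV) (\<lambda>p. root_speed \<gamma> (u (fst p) (snd p)))"
    "continuous_on ({0..T} \<times> UNIV) (\<lambda>p. root_speed_deriv \<gamma> (u (fst p) (snd p)))"
    unfolding root_speed_def root_speed_deriv_def
    by (intro continuous_intros cont_u[unfolded case_prod_unfold]; simp)+
  note cont = R cont_u[unfolded case_prod_unfold] cont_ux[unfolded case_prod_unfold]
    cont_vx[unfolded case_prod_unfold]
  show "continuous_on ({0..T} \<times> UNIV) (\<lambda>(t, x). riem_x s t x)"
    "continuous_on ({0..T} \<times> UNIV) (\<lambda>(t, x). speed s t x)"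
    "continuous_on ({0..T} \<times> UNIV) (\<lambda>(t, x). speed_x s t x)"
    unfolding riem_x_def speed_def speed_x_def case_prod_unfold
    by (intro continuous_intros cont)+
qed

section \<open>Existence of characteristics\<close>

lemma speed_Lipschitz:
  obtains L where "0 \<le> L"
    and "\<And>s t x y. s \<in> {1, -1} \<Longrightarrow> t \<in> {0..T} \<Longrightarrow> \<bar>speed s t x - speed s t y\<bar> \<le> L * \<bar>x - y\<bar>"
proof
  \<comment> \<open>Negative powers decrease, so their values at the lower bound \<open>d\<close> of
    \<open>u\<close> dominate, while \<open>b\<close> bounds \<open>ux\<close>. The constant serves
    both families.\<close>
  define L where "L = 2 * root_speed \<gamma> d * \<bar>root_speed_deriv \<gamma> d\<bar> * b"
  show "0 \<le> L" using b_nonneg root_speed_pos[OF d, of \<gamma>] by (simp add: L_def)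
  fix s t x y :: real assume s: "s \<in> {1, -1}" and t: "t \<in> {0..T}"
  have "\<bar>speed_x s t z\<bar> \<le> L" for z
  proof -
    have "root_speed \<gamma> (u t z) \<le> root_speed \<gamma> d"
      unfolding root_speed_def using \<gamma> d u_ge[OF t] by (intro powr_mono2') auto
    moreover have "\<bar>root_speed_deriv \<gamma> (u t z)\<bar> \<le> \<bar>root_speed_deriv \<gamma> d\<bar>"
      unfolding root_speed_deriv_def abs_mult using \<gamma> d u_ge[OF t]
      by (intro mult_left_mono) (auto intro!: powr_mono2')
    ultimately have "2 * root_speed \<gamma> (u t z) * \<bar>root_speed_deriv \<gamma> (u t z)\<bar> * \<bar>ux t z\<bar> \<le> L"
      unfolding L_def using root_speed_pos[OF d, of \<gamma>] ux_bound[OF t]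
        root_speed_pos[OF u_pos[OF t], of \<gamma> z]
      by (intro mult_mono) auto
    then show ?thesis
      using s root_speed_pos[OF u_pos[OF t], of \<gamma> z] by (auto simp: speed_x_def abs_mult)
  qed
  then show "\<bar>speed s t x - speed s t y\<bar> \<le> L * \<bar>x - y\<bar>"
    using field_differentiable_bound[of UNIV "speed s t" "speed_x s t" L x y]
      speed_has_derivative_x[OF t, of s]
    by simp
qed

lemma characteristic_exists:
  assumes "s \<in> {1, -1}"
  obtains X where "characteristic s X" "X 0 = x0"
proof -
  obtain L where L: "0 \<le> L" "\<And>t x y. t \<in> {0..T} \<Longrightarrow> \<bar>speed s t x - speed s t y\<bar> \<le> L * \<bar>x - y\<bar>"
    using speed_Lipschitz assms by metis
  from Lipschitz_ode_solution_exists[OF T continuous_speed L(2,1), of x0] show ?thesis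
    using that unfolding characteristic_def by metis
qed

lemma terminal_characteristic_exists:
  assumes "s \<in> {1, -1}"
  obtains X where "characteristic s X" "X T = x0"
proof -
  obtain L where L: "0 \<le> L" "\<And>t x y. t \<in> {0..T} \<Longrightarrow> \<bar>speed s t x - speed s t y\<bar> \<le> L * \<bar>x - y\<bar>"
    using speed_Lipschitz assms by metis
  from Lipschitz_ode_terminal_solution_exists[OF T continuous_speed L(2,1), of x0] show ?thesis
    using that unfolding characteristic_def by metis
qed

section \<open>Evolution along one characteristic\<close>

context
  fixes s :: real and X :: "real \<Rightarrow> real"
  assumes s: "s \<in> {1, -1}" and X: "characteristic s X"
begin

lemma riem_along_characteristic:
  assumes t: "t \<in> {0..T}"
  shows "((\<lambda>t. riem s t (X t)) has_real_derivative - damping \<mu> lam t * v t (X t)) (at t within {0..T})"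
proof -
  have "((\<lambda>t. riem s t (X t)) has_real_derivative
      - damping \<mu> lam t * v t (X t) - speed s t (X t) * riem_x s t (X t)
        + riem_x s t (X t) * speed s t (X t)) (at t within {0..T})"
    using X t by (intro real_derivative_along_curve riem_has_derivative_t riem_has_derivative_x
        continuous_riem_x s) (auto simp: characteristic_def)
  then show ?thesis by simp
qed

lemma riem_x_along_characteristic:
  assumes t: "t \<in> {0..T}"
  shows "((\<lambda>t. riem_x s t (X t)) has_real_derivative
    - damping \<mu> lam t * vx t (X t) - speed_x s t (X t) * riem_x s t (X t)) (at t within {0..T})"
proof (rule transport_spatial_derivative_along_characteristic[OF T, where w = "riem s"
      and wx = "riem_x s" and f = "speed s" and fx = "speed_x s"
      and g = "\<lambda>t x. - damping \<mu> lam t * v t x" and gx = "\<lambda>t x. - damping \<mu> lam t * vx t x"])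
  have "\<forall>p\<in>{0..T} \<times> UNIV. (1 + fst p) powr \<mu> \<noteq> 0" by auto
  then show "continuous_on ({0..T} \<times> UNIV) (\<lambda>(t, x). - damping \<mu> lam t * vx t x)"
    unfolding damping_def case_prod_unfold
    by (intro continuous_intros cont_vx[unfolded case_prod_unfold]) auto
  show "((\<lambda>\<tau>. riem s \<tau> x) has_real_derivative
      - damping \<mu> lam t * v t x - speed s t x * riem_x s t x) (at t within {0..T})"
    if "t \<in> {0..T}" for t x
    using riem_has_derivative_t[OF that s] .
  show "((\<lambda>x. - damping \<mu> lam t * v t x) has_real_derivative - damping \<mu> lam t * vx t x) (at x)"
    if "t \<in> {0..T}" for t x
    using vx[OF that] by (rule DERIV_cmult)
qed (use X t in \<open>auto intro!: riem_has_derivative_x speed_has_derivative_x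
    continuous_riem_x continuous_speed_x simp: characteristic_def\<close>)

lemma u_along_characteristic:
  assumes t: "t \<in> {0..T}"
  shows "((\<lambda>t. u t (X t)) has_real_derivative riem_x (- s) t (X t)) (at t within {0..T})"
proof -
  have "((\<lambda>t. u t (X t)) has_real_derivative vx t (X t) + ux t (X t) * speed s t (X t))
      (at t within {0..T})"
    using X t by (intro real_derivative_along_curve ut ux cont_ux) (auto simp: characteristic_def)
  then show ?thesis by (simp add: riem_x_def speed_def algebra_simps)
qed

lemma weighted_along_characteristic:
  assumes t: "t \<in> {0..T}"
  defines "w \<equiv> u t (X t)"
  defines "a \<equiv> damping \<mu> lam t"
  defines "y \<equiv> root_speed \<gamma> w * riem_x s t (X t)"
  shows "((\<lambda>t. weighted s t (X t)) has_real_derivative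
    - ((\<gamma> + 1) / (3 - \<gamma>) * y\<^sup>2 / theta \<gamma> w) - a / 2 * y
      + - (\<mu> * a / (1 + t)) / 2 * theta \<gamma> w) (at t within {0..T})"
proof -
  have w: "w > 0" using u_pos[OF t] by (simp add: w_def)
  note u' = u_along_characteristic[OF t]
  have k: "((\<lambda>t. root_speed \<gamma> (u t (X t))) has_real_derivative
      root_speed_deriv \<gamma> w * riem_x (- s) t (X t)) (at t within {0..T})"
    using DERIV_chain2[OF has_derivative_root_speed u'] w by (simp add: w_def)
  have th: "((\<lambda>t. theta \<gamma> (u t (X t))) has_real_derivative
      root_speed \<gamma> w * riem_x (- s) t (X t)) (at t within {0..T})"
    using DERIV_chain2[OF has_derivative_theta u'] w \<gamma> by (simp add: w_def)
  have a': "(damping \<mu> lam has_real_derivative - (\<mu> * a / (1 + t))) (at t within {0..T})"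
    using has_derivative_damping[of t \<mu> lam] t by (auto simp: a_def intro: has_field_derivative_at_within)
  have d: "((\<lambda>t. weighted s t (X t)) has_real_derivative
      (root_speed_deriv \<gamma> w * riem_x (- s) t (X t) * riem_x s t (X t)
        + (- a * vx t (X t) - speed_x s t (X t) * riem_x s t (X t)) * root_speed \<gamma> w)
      + (- (\<mu> * a / (1 + t)) / 2 * theta \<gamma> w
        + root_speed \<gamma> w * riem_x (- s) t (X t) * (a / 2))) (at t within {0..T})"
    using DERIV_add[OF DERIV_mult[OF k riem_x_along_characteristic[OF t]]
        DERIV_mult[OF DERIV_cdivide[OF a', of 2] th]]
    by (simp add: weighted_def[abs_def] w_def a_def)
  \<comment> \<open>Two relations make the mixed terms cancel: \<open>vx\<close> is the mean of
    \<open>riem_x s\<close> and \<open>riem_x (- s)\<close>, and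
    \<open>speed_x s * root_speed\<close> equals
    \<open>root_speed_deriv * (riem_x (- s) - riem_x s)\<close>.\<close>
  moreover have "root_speed_deriv \<gamma> w * riem_x (- s) t (X t) * riem_x s t (X t)
      + (- a * vx t (X t) - speed_x s t (X t) * riem_x s t (X t)) * root_speed \<gamma> w
      + root_speed \<gamma> w * riem_x (- s) t (X t) * (a / 2)
      = root_speed_deriv \<gamma> w * (riem_x s t (X t))\<^sup>2 - a / 2 * y"
    using s by (auto simp: riem_x_def speed_x_def y_def w_def power2_eq_square algebra_simps)
  moreover have "root_speed_deriv \<gamma> w * (riem_x s t (X t))\<^sup>2
      = - ((\<gamma> + 1) / (3 - \<gamma>) * y\<^sup>2 / theta \<gamma> w)"
    using root_speed_deriv_eq[OF \<gamma>(2) w] by (simp add: y_def power_mult_distrib)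
  ultimately show ?thesis
    by (intro DERIV_cong[OF d]) linarith
qed

lemma weighted_derivative_along_characteristic:
  "\<exists>E. \<forall>t\<in>{0..T}. ((\<lambda>t. weighted s t (X t)) has_real_derivative E t) (at t within {0..T}) \<and>
    E t \<le> 0 \<and>
    (weighted s t (X t) \<le> 0 \<longrightarrow> E t \<le> - ((weighted s t (X t))\<^sup>2 / theta \<gamma> (u t (X t))))"
proof -
  define y where "y t = root_speed \<gamma> (u t (X t)) * riem_x s t (X t)" for t
  define E where "E t = - ((\<gamma> + 1) / (3 - \<gamma>) * (y t)\<^sup>2 / theta \<gamma> (u t (X t))) - damping \<mu> lam t / 2 * y t
      + - (\<mu> * damping \<mu> lam t / (1 + t)) / 2 * theta \<gamma> (u t (X t))" for t
  have "E t \<le> 0 \<and> (weighted s t (X t) \<le> 0 \<longrightarrow>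
      E t \<le> - ((weighted s t (X t))\<^sup>2 / theta \<gamma> (u t (X t))))" if t: "t \<in> {0..T}" for t
  proof -
    \<comment> \<open>This is the factor \<open>K\<close> of \<open>riccati_rhs_bounds\<close>; it
      is at least 1 precisely when \<open>1 \<le> \<gamma> < 3\<close>.\<close>
    have "1 \<le> (\<gamma> + 1) / (3 - \<gamma>)" using \<gamma> by (simp add: le_divide_eq)
    moreover have "0 < theta \<gamma> (u t (X t))" using \<gamma> u_pos[OF t] by (intro theta_pos) auto
    moreover have "0 \<le> damping \<mu> lam t" using lam by (simp add: damping_nonneg)
    moreover have "(damping \<mu> lam t)\<^sup>2 \<le> - 2 * - (\<mu> * damping \<mu> lam t / (1 + t))"
      using damping_square_le[OF lam \<mu>, of t] t by simp
    ultimately show ?thesis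
      unfolding E_def weighted_def y_def[symmetric] by (blast intro: riccati_rhs_bounds)
  qed
  moreover have "((\<lambda>t. weighted s t (X t)) has_real_derivative E t) (at t within {0..T})"
    if "t \<in> {0..T}" for t
    using weighted_along_characteristic[OF that] by (simp only: E_def y_def)
  ultimately show ?thesis by blast
qed

lemma weighted_nonincreasing_along_characteristic:
  assumes t: "t \<in> {0..T}"
  shows "weighted s t (X t) \<le> weighted s 0 (X 0)"
proof -
  obtain E where E: "\<forall>t\<in>{0..T}.
      ((\<lambda>t. weighted s t (X t)) has_real_derivative E t) (at t within {0..T}) \<and> E t \<le> 0"
    using weighted_derivative_along_characteristic by blast
  show ?thesis
  proof (rule nonincreasing_if_deriv_nonpos[of 0 t])
    show "((\<lambda>t. weighted s t (X t)) has_real_derivative E \<tau>) (at \<tau> within {0..t})"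
      if "\<tau> \<in> {0..t}" for \<tau>
      by (rule DERIV_subset[of _ _ _ "{0..T}"]) (use E that t in auto)
  qed (use E t in auto)
qed

text \<open>The derivative of \<open>- 1 / Y + ln (1 + t) / C\<close> along the characteristic is nonpositive.\<close>

lemma ln_time_le_of_weighted_neg:
  assumes neg: "weighted s 0 (X 0) < 0" and C: "C > 0"
    and th: "\<And>t x. t \<in> {0..T} \<Longrightarrow> theta \<gamma> (u t x) \<le> C * (1 + t)"
  shows "ln (1 + T) \<le> C / (- weighted s 0 (X 0))"
proof -
  define Y where "Y t = weighted s t (X t)" for t
  \<comment> \<open>Monotonicity preserves the negative sign, so the reciprocal of \<open>Y\<close>
    is defined on the whole interval.\<close>
  have Y: "Y t < 0" if "t \<in> {0..T}" for t
    using weighted_nonincreasing_along_characteristic[OF that] neg by (simp add: Y_def)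
  obtain E where E: "\<forall>t\<in>{0..T}. (Y has_real_derivative E t) (at t within {0..T}) \<and> E t \<le> 0 \<and>
      (Y t \<le> 0 \<longrightarrow> E t \<le> - ((Y t)\<^sup>2 / theta \<gamma> (u t (X t))))"
    using weighted_derivative_along_characteristic unfolding Y_def[abs_def] by blast
  have "ln (1 + T) / C - inverse (Y T) \<le> ln (1 + 0) / C - inverse (Y 0)"
  proof (rule nonincreasing_if_deriv_nonpos[OF T])
    fix t assume t: "t \<in> {0..T}"
    have "((\<lambda>t. ln (1 + t)) has_real_derivative 1 / (1 + t)) (at t within {0..T})"
      using t by (auto intro!: derivative_eq_intros)
    then have "((\<lambda>t. ln (1 + t) / C - inverse (Y t)) has_real_derivative
        1 / (1 + t) / C - - (E t * inverse ((Y t) ^ Suc (Suc 0)))) (at t within {0..T})"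
      using bspec[OF E t] Y[OF t] by (intro DERIV_diff DERIV_cdivide DERIV_inverse_fun) auto
    then show "((\<lambda>t. ln (1 + t) / C - inverse (Y t)) has_real_derivative
        1 / (1 + t) / C + E t / (Y t)\<^sup>2) (at t within {0..T})"
      by (simp add: divide_inverse numeral_2_eq_2)
    have "0 < theta \<gamma> (u t (X t))" using \<gamma> u_pos[OF t] by (intro theta_pos) auto
    moreover have "E t \<le> - ((Y t)\<^sup>2 / theta \<gamma> (u t (X t)))"
      using bspec[OF E t] Y[OF t] by simp
    ultimately have "E t / (Y t)\<^sup>2 \<le> - ((Y t)\<^sup>2 / theta \<gamma> (u t (X t))) / (Y t)\<^sup>2"
      by (intro divide_right_mono) auto
    also have "\<dots> = - (1 / theta \<gamma> (u t (X t)))" using Y[OF t] by simp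
    also have "\<dots> \<le> - (1 / (C * (1 + t)))"
      using th[OF t] C t \<open>0 < theta \<gamma> (u t (X t))\<close> by (simp add: frac_le)
    finally show "1 / (1 + t) / C + E t / (Y t)\<^sup>2 \<le> 0"
      by (simp add: mult.commute)
  qed
  \<comment> \<open>The positive quantity \<open>- 1 / Y T\<close> is dropped on the left.\<close>
  moreover have "inverse (Y T) < 0" using Y[of T] T by simp
  ultimately have "ln (1 + T) / C \<le> ln (1 + 0) / C - inverse (Y 0)" by linarith
  then have "ln (1 + T) / C \<le> 1 / (- Y 0)" by (simp add: divide_inverse)
  then show ?thesis
    using C by (simp add: Y_def divide_le_eq mult.commute)
qed

text \<open>Let \<open>h\<close> and \<open>k\<close> be the two invariants on the curve, up to a
  common sign. Then \<open>h' = - a * (h + k) / 2\<close>, so \<open>(h - N)' + (h - N)\<close> is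
  half of \<open>(2 - a) * (h - N) + a * (- N - k)\<close>. This is nonpositive since
  \<open>0 \<le> a \<le> 2\<close>. Hence \<open>exp t * (h - N)\<close> does not increase, and a
  gap between \<open>M\<close> and \<open>N\<close> at time 0 survives with the factor
  \<open>exp (- T)\<close>.\<close>

lemma riem_bound_step:
  assumes "M \<le> N" and N: "\<And>t x. t \<in> {0..T} \<Longrightarrow> \<bar>riem s t x\<bar> \<le> N \<and> \<bar>riem (- s) t x\<bar> \<le> N"
    and M: "\<bar>riem s 0 (X 0)\<bar> \<le> M"
  shows "\<bar>riem s T (X T)\<bar> \<le> N - exp (- T) * (N - M)"
proof -
  \<comment> \<open>The sign \<open>\<sigma>\<close> yields the upper and the lower bound at
    once.\<close>
  have "\<sigma> * riem s T (X T) \<le> N - exp (- T) * (N - M)" if \<sigma>: "\<sigma> \<in> {1, -1}" for \<sigma> :: real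
  proof -
    have "exp T * (\<sigma> * riem s T (X T) - N) \<le> exp 0 * (\<sigma> * riem s 0 (X 0) - N)"
    proof (rule nonincreasing_if_deriv_nonpos[OF T])
      fix t assume t: "t \<in> {0..T}"
      let ?a = "damping \<mu> lam t" and ?h = "\<sigma> * riem s t (X t)" and ?k = "\<sigma> * riem (- s) t (X t)"
      show "((\<lambda>t. exp t * (\<sigma> * riem s t (X t) - N)) has_real_derivative
          exp t * (?h - N) + exp t * (\<sigma> * (- ?a * v t (X t)))) (at t within {0..T})"
        by (rule derivative_eq_intros riem_along_characteristic t refl)+ simp
      have "0 \<le> ?a" "?a \<le> 2"
        using damping_nonneg[of lam \<mu> t] damping_le[of lam \<mu> t] lam \<mu> t by auto
      moreover have "?h \<le> N" "- N \<le> ?k"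
        using N[OF t, of "X t"] \<sigma> by (auto simp: abs_le_iff)
      ultimately have "(2 - ?a) * (?h - N) \<le> 0" "?a * (- N - ?k) \<le> 0"
        by (auto intro: mult_nonneg_nonpos)
      then have "((2 - ?a) * (?h - N) + ?a * (- N - ?k)) / 2 \<le> 0"
        by (intro divide_nonpos_pos add_nonpos_nonpos) auto
      also have "((2 - ?a) * (?h - N) + ?a * (- N - ?k)) / 2 = ?h - N + \<sigma> * (- ?a * v t (X t))"
        unfolding v_eq[of t _ s] by (simp add: field_simps)
      finally have "?h - N + \<sigma> * (- ?a * v t (X t)) \<le> 0" .
      then have "exp t * (?h - N + \<sigma> * (- ?a * v t (X t))) \<le> 0"
        by (intro mult_nonneg_nonpos) auto
      then show "exp t * (?h - N) + exp t * (\<sigma> * (- ?a * v t (X t))) \<le> 0"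
        by (simp only: distrib_left)
    qed
    also have "exp 0 * (\<sigma> * riem s 0 (X 0) - N) \<le> M - N"
      using M \<sigma> by (auto simp: abs_le_iff)
    finally have "exp (- T) * (exp T * (\<sigma> * riem s T (X T) - N)) \<le> exp (- T) * (M - N)"
      by (intro mult_left_mono) auto
    moreover have "exp (- T) * (exp T * z) = z" for z
      by (simp add: mult.assoc[symmetric] flip: exp_add)
    ultimately have "\<sigma> * riem s T (X T) - N \<le> exp (- T) * (M - N)" by simp
    then show ?thesis by (simp add: right_diff_distrib)
  qed
  from this[of 1] this[of "-1"] show ?thesis by (simp add: abs_le_iff)
qed

end

section \<open>Bounds on the whole strip\<close>

lemma weighted_le:
  assumes s: "s \<in> {1, -1}" and t: "t \<in> {0..T}" and C: "\<And>x. weighted s 0 x \<le> C"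
  shows "weighted s t x \<le> C"
proof -
  interpret past: damped_flow \<gamma> \<mu> lam t b d u v ux vx by (rule restrict[OF t])
  obtain X where X: "past.characteristic s X" "X t = x"
    using past.terminal_characteristic_exists[OF s] by blast
  have "weighted s t (X t) \<le> weighted s 0 (X 0)"
    using past.weighted_nonincreasing_along_characteristic[OF s X(1), of t] t by simp
  with C[of "X 0"] X(2) show ?thesis by simp
qed

text \<open>The time derivative of \<open>theta\<close> at fixed \<open>x\<close> is
  \<open>root_speed * vx\<close>, and \<open>vx\<close> is the mean of the two
  \<open>riem_x\<close>. Each of them, times \<open>root_speed\<close>, is at most
  \<open>weighted\<close>, whose \<open>theta\<close> term is nonnegative.\<close>

lemma theta_le:
  assumes C: "\<And>s x. s \<in> {1, -1} \<Longrightarrow> weighted s 0 x \<le> C" and t: "t \<in> {0..T}"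
  shows "theta \<gamma> (u t x) \<le> theta \<gamma> (u 0 x) + C * t"
proof -
  have "theta \<gamma> (u t x) - C * t \<le> theta \<gamma> (u 0 x) - C * 0"
  proof (rule nonincreasing_if_deriv_nonpos[where f = "\<lambda>\<tau>. theta \<gamma> (u \<tau> x) - C * \<tau>"
        and f' = "\<lambda>\<tau>. root_speed \<gamma> (u \<tau> x) * vx \<tau> x - C"])
    fix \<tau> assume "\<tau> \<in> {0..t}"
    then have \<tau>: "\<tau> \<in> {0..T}" "{0..t} \<subseteq> {0..T}" using t by auto
    show "((\<lambda>\<tau>. theta \<gamma> (u \<tau> x) - C * \<tau>) has_real_derivative
        root_speed \<gamma> (u \<tau> x) * vx \<tau> x - C) (at \<tau> within {0..t})"
      using DERIV_chain2[OF has_derivative_theta DERIV_subset[OF ut]] \<tau> \<gamma> u_pos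
      by (auto intro!: derivative_eq_intros)
    have "0 \<le> damping \<mu> lam \<tau> / 2 * theta \<gamma> (u \<tau> x)"
      using lam \<gamma> u_pos[OF \<tau>(1)] by (simp add: damping_nonneg theta_pos less_imp_le)
    then have "root_speed \<gamma> (u \<tau> x) * riem_x s \<tau> x \<le> C" if "s \<in> {1, -1}" for s
      using weighted_le[OF that \<tau>(1) C[OF that], of x] by (simp add: weighted_def)
    from this[of 1] this[of "-1"] show "root_speed \<gamma> (u \<tau> x) * vx \<tau> x - C \<le> 0"
      by (simp add: riem_x_def algebra_simps)
  qed (use t in auto)
  then show ?thesis by simp
qed

text \<open>The damping couples the two invariants, so they are bounded together by their common
  supremum \<open>N\<close>. It need not be attained on the unbounded line. If \<open>N\<close>
  exceeded \<open>M\<close>, \<open>riem_bound_step\<close> would place all values below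
  \<open>N\<close> by a uniform amount, contradicting the choice of \<open>N\<close>.\<close>

lemma riem_le_initial:
  assumes M: "\<And>s x. s \<in> {1, -1} \<Longrightarrow> \<bar>riem s 0 x\<bar> \<le> M"
    and s: "s \<in> {1, -1}" and t: "t \<in> {0..T}"
  shows "\<bar>riem s t x\<bar> \<le> M"
proof -
  define S where "S = {\<bar>riem s t x\<bar> | s t x. s \<in> {1, -1} \<and> t \<in> {0..T}}"
  define N where "N = Sup S"
  \<comment> \<open>A crude bound whose only purpose is to make the supremum finite.\<close>
  have "\<bar>riem s t x\<bar> \<le> b + eta \<gamma> d" if "s \<in> {1, -1}" "t \<in> {0..T}" for s t x
    using that v_bound[of t x] eta_pos[OF \<gamma>(1) u_pos, of t x] eta_antimono[OF \<gamma>(1) d u_ge, of t x]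
    by (auto simp: riem_def abs_le_iff)
  then have bdd: "bdd_above S" by (auto simp: S_def intro!: bdd_aboveI)
  have S_le: "\<bar>riem s t x\<bar> \<le> N" if "s \<in> {1, -1}" "t \<in> {0..T}" for s t x
    unfolding N_def by (rule cSup_upper[OF _ bdd]) (use that in \<open>auto simp: S_def\<close>)
  have "N \<le> M"
  proof (rule ccontr)
    assume "\<not> N \<le> M"
    have "y \<le> N - exp (- T) * (N - M)" if y: "y \<in> S" for y
    proof -
      obtain s t x where y: "y = \<bar>riem s t x\<bar>" and s: "s \<in> {1, -1}" and t: "t \<in> {0..T}"
        using y unfolding S_def by blast
      interpret past: damped_flow \<gamma> \<mu> lam t b d u v ux vx by (rule restrict[OF t])
      obtain X where X: "past.characteristic s X" "X t = x"
        using past.terminal_characteristic_exists[OF s] by blast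
      have "\<bar>riem s t (X t)\<bar> \<le> N - exp (- t) * (N - M)"
        using \<open>\<not> N \<le> M\<close> S_le[of s] S_le[of "- s"] M[OF s] t s
        by (intro past.riem_bound_step[OF s X(1)]) auto
      also have "\<dots> \<le> N - exp (- T) * (N - M)"
        using \<open>\<not> N \<le> M\<close> t by (simp add: mult_right_mono)
      finally show ?thesis using y X by simp
    qed
    moreover have "S \<noteq> {}" using T by (force simp: S_def)
    ultimately have "N \<le> N - exp (- T) * (N - M)" unfolding N_def by (intro cSup_least)
    then have "exp (- T) * (N - M) \<le> 0" by simp
    with \<open>\<not> N \<le> M\<close> show False by (simp add: mult_le_0_iff)
  qed
  with S_le[OF s t, of x] show ?thesis by simp
qed

text \<open>One constant \<open>C\<close> bounds the initial \<open>theta\<close> and its growth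
  rate, which gives \<open>theta \<le> C * (1 + t)\<close>. The right-hand side is independent of
  \<open>T\<close> and thus limits the time of existence.\<close>

lemma lifespan_bound:
  assumes C: "\<And>s x. s \<in> {1, -1} \<Longrightarrow> weighted s 0 x \<le> C" and "0 \<le> C"
    and th: "\<And>x. theta \<gamma> (u 0 x) \<le> C" and s: "s \<in> {1, -1}" and neg: "weighted s 0 x0 < 0"
  shows "ln (1 + T) \<le> C / (- weighted s 0 x0)"
proof -
  obtain X where X: "characteristic s X" "X 0 = x0"
    using characteristic_exists[OF s] by blast
  have "0 < C" using theta_pos[OF \<gamma>(2) u_pos, of 0 x0] th[of x0] T by simp
  moreover have "theta \<gamma> (u t x) \<le> C * (1 + t)" if "t \<in> {0..T}" for t x
    using theta_le[OF C that, of x] th[of x] by (simp add: algebra_simps)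
  ultimately show ?thesis
    using ln_time_le_of_weighted_neg[OF s X(1), of C] neg X(2) by simp
qed

end

section \<open>The Cauchy problem\<close>

text \<open>Converts bounds on the derivative of the pressure and on \<open>eta\<close> into lower
  bounds on \<open>u\<close>; \<open>ge_of_powr_le\<close> converts a bound on \<open>theta\<close>
  into an upper one.\<close>

lemma le_of_powr_minus_le:
  fixes w k R :: real
  assumes "k > 0" "w > 0" "w powr (- k) \<le> R"
  shows "R powr (- 1 / k) \<le> w"
proof -
  have "R powr (- 1 / k) \<le> (w powr (- k)) powr (- 1 / k)"
    using assms by (intro powr_mono2') auto
  also have "\<dots> = w" using assms by (simp add: powr_powr)
  finally show ?thesis .
qed

lemma ge_of_powr_le:
  fixes w k R :: real
  assumes "k > 0" "w > 0" "w powr k \<le> R"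
  shows "w \<le> R powr (1 / k)"
proof -
  have "w = (w powr k) powr (1 / k)" using assms by (simp add: powr_powr)
  also have "\<dots> \<le> R powr (1 / k)"
    using assms by (intro powr_mono2) auto
  finally show ?thesis .
qed

lemma sup_norm_ge: "ereal \<bar>f x\<bar> \<le> sup_norm f"
  unfolding sup_norm_def by (intro SUP_upper) auto

lemma sup_norm_nonneg: "0 \<le> sup_norm f"
  by (rule order_trans[OF _ sup_norm_ge[of f 0]]) simp

lemma sup_norm_le: "(\<And>x. \<bar>f x\<bar> \<le> B) \<Longrightarrow> sup_norm f \<le> ereal B"
  unfolding sup_norm_def by (intro SUP_least) auto

lemma bounded_stripE:
  assumes "bounded_strip \<gamma> T u v"
  obtains B where "\<And>t x. t \<in> {0..<T} \<Longrightarrow> \<bar>u t x\<bar> \<le> B \<and> \<bar>v t x\<bar> \<le> B \<and>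
    \<bar>Dx u t x\<bar> \<le> B \<and> \<bar>Dx v t x\<bar> \<le> B \<and> \<bar>deriv (pressure \<gamma>) (u t x)\<bar> \<le> B"
proof -
  define F where "F t = (sup_norm (u t) + sup_norm (v t)) +
        (sup_norm (Dt u t) + sup_norm (Dt v t)) +
        (sup_norm (Dx u t) + sup_norm (Dx v t)) +
        sup_norm (\<lambda>x. deriv (pressure \<gamma>) (u t x))" for t
  have "(SUP t\<in>{0..<T}. F t) < \<infinity>"
    using assms unfolding bounded_strip_def F_def .
  \<comment> \<open>For an empty time interval the supremum is \<open>-\<infinity>\<close>, hence an
    upper bound rather than a real value.\<close>
  then obtain B where "(SUP t\<in>{0..<T}. F t) \<le> ereal B"
    by (cases "SUP t\<in>{0..<T}. F t") auto
  then have F: "F t \<le> ereal B" if "t \<in> {0..<T}" for t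
    using that by (meson SUP_upper order_trans)
  show ?thesis
  proof (rule that[of B])
    fix t x assume t: "t \<in> {0..<T}"
    have "sup_norm (u t) \<le> F t" "sup_norm (v t) \<le> F t" "sup_norm (Dx u t) \<le> F t"
      "sup_norm (Dx v t) \<le> F t" "sup_norm (\<lambda>x. deriv (pressure \<gamma>) (u t x)) \<le> F t"
      unfolding F_def by (auto intro!: sup_norm_nonneg add_nonneg_nonneg
          intro: add_increasing add_increasing2 order_refl)
    from this[THEN order_trans[OF sup_norm_ge], THEN order_trans[OF _ F[OF t]], of x]
    show "\<bar>u t x\<bar> \<le> B \<and> \<bar>v t x\<bar> \<le> B \<and> \<bar>Dx u t x\<bar> \<le> B \<and>
        \<bar>Dx v t x\<bar> \<le> B \<and> \<bar>deriv (pressure \<gamma>) (u t x)\<bar> \<le> B"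
      by simp
  qed
qed

lemma
  assumes "C1_strip T f" "t \<in> {0..<T}"
  shows C1_strip_has_derivative_t:
      "((\<lambda>\<tau>. f \<tau> x) has_real_derivative Dt f t x) (at t within {0..})"
    and C1_strip_has_derivative_x: "(f t has_real_derivative Dx f t x) (at x)"
proof -
  from assms have D: "(\<lambda>\<tau>. f \<tau> x) differentiable (at t within {0..})" "f t differentiable (at x)"
    by (auto simp: C1_strip_def)
  show "((\<lambda>\<tau>. f \<tau> x) has_real_derivative Dt f t x) (at t within {0..})"
    using D(1) by (simp add: Dt_def has_real_derivative_iff_has_vector_derivative vector_derivative_works)
  show "(f t has_real_derivative Dx f t x) (at x)"
    using D(2) by (simp add: Dx_def DERIV_deriv_iff_real_differentiable)
qed

lemma C1_strip_slice_in_C1b: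
  assumes f: "C1_strip T f" and t: "t \<in> {0..<T}"
    and "\<And>x. \<bar>f t x\<bar> \<le> B" "\<And>x. \<bar>Dx f t x\<bar> \<le> B"
  shows "f t \<in> C1b"
proof -
  have "f t differentiable_on UNIV"
    using f t by (auto simp: C1_strip_def differentiable_on_def)
  moreover have "continuous_on UNIV ((\<lambda>(t, x). Dx f t x) \<circ> (\<lambda>x. (t, x)))"
    using f t by (intro continuous_on_compose continuous_intros)
      (auto simp: C1_strip_def intro: continuous_on_subset)
  then have "continuous_on UNIV (deriv (f t))"
    by (simp add: o_def Dx_def)
  ultimately show ?thesis
    using assms(3,4) by (auto simp: C1b_def Dx_def intro!: boundedI)
qed

text \<open>Stopping strictly before \<open>T'\<close> gives a closed time interval on which the
  bounds of the half-open strip hold. The pressure gradient is expanded by the chain rule.\<close>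

lemma damped_flow_of_solution:
  assumes \<gamma>: "1 < \<gamma>" "\<gamma> < 3" and \<mu>: "1 \<le> \<mu>" and lam: "0 \<le> lam" "lam \<le> 2"
    and sol: "C1_solution \<gamma> \<mu> lam u0 v0 T' u v" and bdd: "bounded_strip \<gamma> T' u v"
    and T: "0 \<le> T" "T < T'"
  obtains b d where "damped_flow \<gamma> \<mu> lam T b d u v (Dx u) (Dx v)"
proof -
  obtain B where B: "\<And>t x. t \<in> {0..<T'} \<Longrightarrow> \<bar>u t x\<bar> \<le> B \<and> \<bar>v t x\<bar> \<le> B \<and>
      \<bar>Dx u t x\<bar> \<le> B \<and> \<bar>Dx v t x\<bar> \<le> B \<and> \<bar>deriv (pressure \<gamma>) (u t x)\<bar> \<le> B"
    using bounded_stripE[OF bdd] by blast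
  \<comment> \<open>The bound \<open>u powr (- (\<gamma> + 1)) \<le> B\<close> on the derivative of
    the pressure, solved for \<open>u\<close>.\<close>
  define d where "d = B powr (- 1 / (\<gamma> + 1))"
  have u: "C1_strip T' u" and v: "C1_strip T' v"
    and pos: "\<And>t x. t \<in> {0..<T'} \<Longrightarrow> u t x > 0"
    and eq1: "\<And>t x. t \<in> {0..<T'} \<Longrightarrow> Dt u t x = Dx v t x"
    and eq2: "\<And>t x. t \<in> {0..<T'} \<Longrightarrow>
      Dt v t x + Dx (\<lambda>\<tau> y. pressure \<gamma> (u \<tau> y)) t x = - damping \<mu> lam t * v t x"
    using sol by (auto simp: C1_solution_def damping_def)
  have u_ge: "d \<le> u t x" if "t \<in> {0..<T'}" for t x
    using B[OF that, of x] pos[OF that, of x] \<gamma>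
    unfolding d_def by (intro le_of_powr_minus_le) (auto simp: deriv_pressure)
  have "damped_flow \<gamma> \<mu> lam T B d u v (Dx u) (Dx v)"
  proof
    fix t x assume "t \<in> {0..T}"
    then have t: "t \<in> {0..<T'}" "{0..T} \<subseteq> {0..}" using T by auto
    show "((\<lambda>\<tau>. u \<tau> x) has_real_derivative Dx v t x) (at t within {0..T})"
      using DERIV_subset[OF C1_strip_has_derivative_t[OF u t(1)] t(2)] eq1[OF t(1)] by simp
    show ux: "(u t has_real_derivative Dx u t x) (at x)"
      by (rule C1_strip_has_derivative_x[OF u t(1)])
    show "(v t has_real_derivative Dx v t x) (at x)"
      by (rule C1_strip_has_derivative_x[OF v t(1)])
    have "((\<lambda>y. pressure \<gamma> (u t y)) has_real_derivative
        - (root_speed \<gamma> (u t x) ^ 4) * Dx u t x) (at x)"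
      using DERIV_chain2[OF has_derivative_pressure[OF _ pos[OF t(1)]] ux] \<gamma> by simp
    then have "Dx (\<lambda>\<tau> y. pressure \<gamma> (u \<tau> y)) t x = - (root_speed \<gamma> (u t x) ^ 4) * Dx u t x"
      unfolding Dx_def by (rule DERIV_imp_deriv)
    then have "Dt v t x = root_speed \<gamma> (u t x) ^ 4 * Dx u t x - damping \<mu> lam t * v t x"
      using eq2[OF t(1), of x] by simp
    then show "((\<lambda>\<tau>. v \<tau> x) has_real_derivative
        root_speed \<gamma> (u t x) ^ 4 * Dx u t x - damping \<mu> lam t * v t x) (at t within {0..T})"
      using DERIV_subset[OF C1_strip_has_derivative_t[OF v t(1)] t(2)] by metis
    show "d \<le> u t x" "\<bar>v t x\<bar> \<le> B" "\<bar>Dx u t x\<bar> \<le> B"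
      using u_ge B t by auto
  next
    have "{0..T} \<times> UNIV \<subseteq> {0..<T'} \<times> (UNIV :: real set)" using T by auto
    then show "continuous_on ({0..T} \<times> UNIV) (\<lambda>(t, x). u t x)"
      "continuous_on ({0..T} \<times> UNIV) (\<lambda>(t, x). Dx u t x)"
      "continuous_on ({0..T} \<times> UNIV) (\<lambda>(t, x). Dx v t x)"
      using u v unfolding C1_strip_def by (meson continuous_on_subset)+
    \<comment> \<open>The power of \<open>B\<close> would vanish for \<open>B = 0\<close>; the
      nonzero derivative of the pressure at one point excludes this.\<close>
    have "0 < T'" using T by simp
    then have "deriv (pressure \<gamma>) (u 0 0) < 0" "\<bar>deriv (pressure \<gamma>) (u 0 0)\<bar> \<le> B"
      using B[of 0 0] pos[of 0 0] \<gamma> by (auto simp: deriv_pressure)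
    then show "0 < d" by (auto simp: d_def)
  qed (use \<gamma> \<mu> lam T in auto)
  then show ?thesis by (rule that)
qed

theorem theorem2p2:
  fixes \<gamma> \<mu> lam m \<delta> :: real
    and u0 v0 :: "real \<Rightarrow> real"
    and u v :: "real \<Rightarrow> real \<Rightarrow> real"
    and Tstar :: ereal
  assumes "1 < \<gamma>" and "\<gamma> < 3"
    and "\<mu> \<ge> 1"
    and "0 \<le> lam" and "lam \<le> 2"
    and "m > 0" and "\<delta> > 0"
    and "(u0, v0) \<in> X_space m \<delta>"
    and "Tstar = lifespan \<gamma> \<mu> lam u0 v0"
    and "C1_solution_upto_lifespan \<gamma> \<mu> lam u0 v0 u v"
    and "\<exists>x0. sqrt (wave_speed \<gamma> (u0 x0)) * deriv (riemann_r \<gamma> u0 v0) x0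
                 < - (lam / 2) * theta \<gamma> (u0 x0)
            \<or> sqrt (wave_speed \<gamma> (u0 x0)) * deriv (riemann_s \<gamma> u0 v0) x0
                 < - (lam / 2) * theta \<gamma> (u0 x0)"
  shows "Tstar < \<infinity> \<and>
    (\<exists>m1>0. \<exists>\<delta>1>0. \<forall>t. 0 \<le> t \<and> ereal t < Tstar \<longrightarrow> (u t, v t) \<in> X_space m1 \<delta>1)"
proof (cases "0 < Tstar")
  \<comment> \<open>A nonpositive lifespan leaves no time \<open>t\<close> to consider, and any
    positive constants will do.\<close>
  case False
  have "\<not> (0 \<le> t \<and> ereal t < Tstar)" for t
    using False by (metis ereal_less_eq(5) less_le_trans not_less order_le_less_trans)
  moreover have "Tstar < \<infinity>" using False by (auto simp: not_less)
  ultimately show ?thesis by (meson zero_less_one)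
next
  case True
  note \<gamma> = assms(1,2)
  have sol: "C1_solution \<gamma> \<mu> lam u0 v0 T u v \<and> bounded_strip \<gamma> T u v"
    if "0 < T" "ereal T < Tstar" for T
    using assms(9,10) that by (auto simp: C1_solution_upto_lifespan_def)
  \<comment> \<open>The solution is given on half-open intervals; a slightly later time makes
    \<open>[0, T]\<close> lie inside one of them.\<close>
  have later: "\<exists>T'. T < T' \<and> ereal T' < Tstar" if "ereal T < Tstar" for T
    using ereal_dense2[OF that] by auto
  have flow: "\<exists>b d. damped_flow \<gamma> \<mu> lam T b d u v (Dx u) (Dx v)"
    if T: "0 \<le> T" "ereal T < Tstar" for T
  proof -
    obtain T' where T': "T < T'" "ereal T' < Tstar" using later[OF T(2)] by blast
    then show ?thesis
      using damped_flow_of_solution[OF assms(1-5), of u0 v0 T' u v T] sol[of T'] T by fastforce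
  qed
  \<comment> \<open>The degenerate interval gives access to the initial time. Since
    \<open>riem\<close> and \<open>weighted\<close> do not depend on \<open>T\<close>,
    \<open>b\<close> or \<open>d\<close>, they are the same functions in every later
    interpretation.\<close>
  obtain b0 d0 where "damped_flow \<gamma> \<mu> lam 0 b0 d0 u v (Dx u) (Dx v)"
    using flow[of 0] True by (auto simp: zero_ereal_def)
  then interpret start: damped_flow \<gamma> \<mu> lam 0 b0 d0 u v "Dx u" "Dx v" .
  obtain T0 where "0 < T0" "ereal T0 < Tstar"
    using later[of 0] True by (auto simp: zero_ereal_def)
  then have init: "u 0 = u0" "v 0 = v0"
    using sol[of T0] by (auto simp: C1_solution_def)
  have u0: "\<delta> \<le> u0 x" "0 < u0 x" for x
    using assms(7,8) by (auto simp: X_space_def intro: less_le_trans)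
  have "bounded (range u0)" "bounded (range v0)" "bounded (range (deriv u0))" "bounded (range (deriv v0))"
    using assms(8) by (auto simp: X_space_def C1b_def)
  then have "bounded (range u0 \<union> range v0 \<union> range (deriv u0) \<union> range (deriv v0))"
    by simp
  then obtain B where B: "\<And>x. \<bar>u0 x\<bar> \<le> B" "\<And>x. \<bar>v0 x\<bar> \<le> B"
    "\<And>x. \<bar>deriv u0 x\<bar> \<le> B" "\<And>x. \<bar>deriv v0 x\<bar> \<le> B"
    unfolding bounded_iff real_norm_def by blast
  have "0 \<le> B" using B(1)[of 0] by simp

  \<comment> \<open>Constants from the initial data\<close>
  define M where "M = B + eta \<gamma> \<delta>"
  \<comment> \<open>\<open>B\<close> bounds the velocity, and \<open>eta\<close> decreases, so its
    value at \<open>\<delta>\<close> bounds it on the initial data.\<close>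
  have M: "\<bar>start.riem s 0 x\<bar> \<le> M" if "s \<in> {1, -1}" for s x
    using that B(2)[of x] eta_pos[OF \<gamma>(1) u0(2)[of x]] eta_antimono[OF \<gamma>(1) assms(7) u0(1)[of x]]
    by (auto simp: start.riem_def init M_def abs_le_iff)

  define k where "k = root_speed \<gamma> \<delta>"
  \<comment> \<open>The first summand bounds \<open>root_speed * riem_x\<close> for both families.
    The second bounds the initial \<open>theta\<close>, and the damping term as well because
    \<open>lam / 2 \<le> 1\<close>.\<close>
  define C where "C = k * (B + k\<^sup>2 * B) + theta \<gamma> B"
  have k: "0 < k" "root_speed \<gamma> (u0 x) \<le> k" for x
    using root_speed_pos[OF assms(7)] u0(1)[of x] assms(7) \<gamma>
    by (auto simp: k_def root_speed_def intro: powr_mono2')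
  have theta0: "theta \<gamma> (u0 x) \<le> theta \<gamma> B" "0 \<le> theta \<gamma> B" for x
    using B(1)[of x] u0(2)[of x] \<gamma>
    by (auto simp: theta_def intro!: divide_right_mono powr_mono2)
  have "theta \<gamma> (u 0 x) \<le> C" for x
    using theta0(1)[of x] k(1) \<open>0 \<le> B\<close> by (simp add: C_def init add_increasing)
  moreover have "0 \<le> C" using theta0(2) k(1) \<open>0 \<le> B\<close> by (simp add: C_def)
  moreover have "start.weighted s 0 x \<le> C" if s: "s \<in> {1, -1}" for s x
  proof -
    have pos: "0 < root_speed \<gamma> (u0 x)" by (rule root_speed_pos[OF u0(2)])
    have "s * deriv u0 x \<le> B" using s B(3)[of x] by (auto simp: abs_le_iff)
    then have "(root_speed \<gamma> (u0 x))\<^sup>2 * (s * deriv u0 x) \<le> (root_speed \<gamma> (u0 x))\<^sup>2 * B"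
      by (intro mult_left_mono) auto
    also have "\<dots> \<le> k\<^sup>2 * B"
      using k(2)[of x] pos \<open>0 \<le> B\<close> by (intro mult_right_mono power_mono) auto
    finally have "start.riem_x s 0 x \<le> B + k\<^sup>2 * B"
      using B(4)[of x] by (simp add: start.riem_x_def init Dx_def abs_le_iff mult_ac)
    then have "root_speed \<gamma> (u0 x) * start.riem_x s 0 x \<le> root_speed \<gamma> (u0 x) * (B + k\<^sup>2 * B)"
      using pos by (intro mult_left_mono) auto
    also have "\<dots> \<le> k * (B + k\<^sup>2 * B)"
      using k(2)[of x] \<open>0 \<le> B\<close> by (intro mult_right_mono) auto
    finally have "root_speed \<gamma> (u0 x) * start.riem_x s 0 x \<le> k * (B + k\<^sup>2 * B)" .
    moreover have "lam / 2 * theta \<gamma> (u0 x) \<le> 1 * theta \<gamma> B"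
      using assms(4,5) theta0(1)[of x] theta0(2) theta_pos[OF \<gamma>(2) u0(2)[of x]] by (intro mult_mono) auto
    ultimately show ?thesis
      by (simp add: start.weighted_def init C_def damping_at_0)
  qed
  ultimately have C: "\<And>x. theta \<gamma> (u 0 x) \<le> C" "0 \<le> C"
    "\<And>s x. s \<in> {1, -1} \<Longrightarrow> start.weighted s 0 x \<le> C" by auto

  \<comment> \<open>Finiteness of the lifespan\<close>
  obtain s x0 where s: "s \<in> {1, -1}" and neg: "start.weighted s 0 x0 < 0"
  proof -
    have eq: "riemann_r \<gamma> u0 v0 = start.riem 1 0" "riemann_s \<gamma> u0 v0 = start.riem (-1) 0"
      by (auto simp: riemann_r_def riemann_s_def start.riem_def init)
    have "deriv (start.riem s 0) x = start.riem_x s 0 x" for s x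
      using start.riem_has_derivative_x[of 0] by (simp add: DERIV_imp_deriv)
    \<comment> \<open>The damping equals \<open>lam\<close> at time 0, so the hypothesis says
      exactly that \<open>weighted\<close> is negative at \<open>x0\<close> for one of the
      signs.\<close>
    then obtain x0 s where "s \<in> {1, -1}" "root_speed \<gamma> (u0 x0) * start.riem_x s 0 x0 < - (lam / 2) * theta \<gamma> (u0 x0)"
      using assms(11) u0(2) \<gamma> by (auto simp: eq sqrt_wave_speed)
    then show ?thesis
      by (intro that[of s x0]) (auto simp: start.weighted_def init damping_at_0)
  qed
  define R where "R = C / (- start.weighted s 0 x0)"
  have R: "ln (1 + T) \<le> R" if T: "0 \<le> T" "ereal T < Tstar" for T
  proof -
    obtain b d where "damped_flow \<gamma> \<mu> lam T b d u v (Dx u) (Dx v)" using flow[OF T] by blast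
    from damped_flow.lifespan_bound[OF this C(3,2,1) s neg] show ?thesis by (simp add: R_def)
  qed
  \<comment> \<open>If \<open>exp R\<close> were an admissible time, \<open>R\<close> would be at
    least \<open>ln (1 + exp R)\<close>, which exceeds \<open>R\<close>.\<close>
  have "Tstar \<le> ereal (exp R)"
  proof (rule ccontr)
    assume "\<not> Tstar \<le> ereal (exp R)"
    then have "ln (1 + exp R) \<le> R" by (intro R) auto
    moreover have "ln (exp R) < ln (1 + exp R)" by (subst ln_less_cancel_iff) (auto simp: add_pos_pos)
    ultimately show False by simp
  qed
  then have finite: "Tstar < \<infinity>" by (rule order_le_less_trans) simp

  \<comment> \<open>Uniform bounds up to the lifespan\<close>
  define K where "K = ((3 - \<gamma>) / 4 * (C + C * exp R)) powr (1 / ((3 - \<gamma>) / 4))"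
  \<comment> \<open>\<open>K\<close> solves \<open>theta \<gamma> u = C + C * exp R\<close> for
    \<open>u\<close>, and \<open>\<delta>1\<close> solves \<open>eta \<gamma> u = M\<close>.\<close>
  define \<delta>1 where "\<delta>1 = ((\<gamma> - 1) / 2 * M) powr (- 1 / ((\<gamma> - 1) / 2))"
  have "0 < M" using eta_pos[OF \<gamma>(1) assms(7)] \<open>0 \<le> B\<close> by (simp add: M_def)
  then have "0 < \<delta>1" using \<gamma> by (simp add: \<delta>1_def)
  have "0 \<le> K" by (simp add: K_def)
  have "(u t, v t) \<in> X_space (K + M) \<delta>1" if t: "0 \<le> t" "ereal t < Tstar" for t
  proof -
    obtain b d where "damped_flow \<gamma> \<mu> lam t b d u v (Dx u) (Dx v)" using flow[OF t] by blast
    then interpret flow: damped_flow \<gamma> \<mu> lam t b d u v "Dx u" "Dx v" .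
    have tt: "t \<in> {0..t}" using t by simp
    have riem: "\<bar>start.riem s t x\<bar> \<le> M" if "s \<in> {1, -1}" for s x
      by (rule flow.riem_le_initial[OF M that tt])
    have v_le: "\<bar>v t x\<bar> \<le> M" for x
      using riem[of 1 x] riem[of "-1" x] by (auto simp: flow.v_eq[of t x 1] abs_le_iff)
    have u_ge: "\<delta>1 \<le> u t x" for x
    proof -
      \<comment> \<open>\<open>eta\<close> is half the difference of the two invariants.\<close>
      have "eta \<gamma> (u t x) \<le> M"
        using riem[of 1 x] riem[of "-1" x] by (auto simp: start.riem_def abs_le_iff)
      then have "(u t x) powr (- ((\<gamma> - 1) / 2)) \<le> (\<gamma> - 1) / 2 * M"
        using eta_eq[OF \<gamma>(1) flow.u_pos[OF tt]] \<gamma> by (simp add: field_simps)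
      then show ?thesis
        unfolding \<delta>1_def using \<gamma> flow.u_pos[OF tt] by (intro le_of_powr_minus_le) auto
    qed
    \<comment> \<open>The linear growth of \<open>theta\<close> becomes a uniform bound because all
      times are already below \<open>exp R\<close>.\<close>
    have u_le: "u t x \<le> K" for x
    proof -
      have "ereal t \<le> ereal (exp R)" using t(2) \<open>Tstar \<le> ereal (exp R)\<close> by (rule order.strict_implies_order[OF order_less_le_trans])
      then have "C * t \<le> C * exp R" using C(2) by (intro mult_left_mono) auto
      then have "theta \<gamma> (u t x) \<le> C + C * exp R"
        using flow.theta_le[OF C(3) tt, of x] C(1)[of x] by simp
      then have "(u t x) powr ((3 - \<gamma>) / 4) \<le> (3 - \<gamma>) / 4 * (C + C * exp R)"
        using \<gamma> by (simp add: theta_def field_simps)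
      then show ?thesis
        unfolding K_def using \<gamma> flow.u_pos[OF tt] by (intro ge_of_powr_le) auto
    qed
    \<comment> \<open>Time \<open>t\<close> lies inside the strip up to \<open>T'\<close>, which
      supplies the regularity of the slices.\<close>
    obtain T' where T': "t < T'" "ereal T' < Tstar" using later[OF t(2)] by blast
    then have T'_sol: "C1_solution \<gamma> \<mu> lam u0 v0 T' u v" "bounded_strip \<gamma> T' u v"
      using sol[of T'] t by auto
    obtain B' where "\<And>\<tau> x. \<tau> \<in> {0..<T'} \<Longrightarrow> \<bar>u \<tau> x\<bar> \<le> B' \<and> \<bar>v \<tau> x\<bar> \<le> B' \<and>
        \<bar>Dx u \<tau> x\<bar> \<le> B' \<and> \<bar>Dx v \<tau> x\<bar> \<le> B' \<and> \<bar>deriv (pressure \<gamma>) (u \<tau> x)\<bar> \<le> B'"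
      using bounded_stripE[OF T'_sol(2)] by blast
    then have "u t \<in> C1b" "v t \<in> C1b"
      using T'_sol(1) T' t by (auto simp: C1_solution_def intro!: C1_strip_slice_in_C1b[of T' _ t B'])
    moreover have "\<bar>u t x\<bar> \<le> K" for x
      using u_le[of x] flow.u_pos[OF tt, of x] by simp
    then have "sup_norm (u t) + sup_norm (v t) \<le> ereal K + ereal M"
      using v_le by (intro add_mono sup_norm_le)
    ultimately show ?thesis
      using u_ge by (simp add: X_space_def)
  qed
  then show ?thesis
    using finite \<open>0 < \<delta>1\<close> \<open>0 < M\<close> \<open>0 \<le> K\<close> by (intro conjI exI[of _ "K + M"] exI[of _ \<delta>1]) auto
qed

end
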